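(* Let $A$ be a reduced tabular algebra with trace $\tau$ and with tabular basis $\mathbf B$, and let $(\Lambda,\Gamma,B,M,C,* )$ be a reduced table datum for $A$ with $\operatorname{Im}(C)=\mathbf B$ (with tabular trace $\tau$). Let $\phi$ be an $\mathcal A$-algebra automorphism of $A$ preserving $\mathbf B$ setwise. Then $\phi$ (restricted to $\mathbf B$) is of the form $C\circ\theta\circ C^{-1}$ for some automorphism $\theta$ of the object $D:=(\Lambda,\Gamma,B,M,* )$ in the category $\mathcal D(A,\mathbf B)$.
   Context: **Normalized table algebras.** A normalized table algebra (over $\mathbb Z$) is a pair $(\Gamma,B)$ where $\Gamma$ is an associative unital $\mathbb Z$-algebra with $\mathbb Z$-basis $B=\{b_i: i\in I\}$, $1\in B$, such that: (T1) the structure constants with respect to $B$ are nonnegative integers; (T2) there is an algebra anti-automorphism $\bar{\ }$ of $\Gamma$ whose square is the identity and which maps $B$ to $B$; (T3) writing $\kappa(b,a)$ for the coefficient of $b\in B$ in $a\in\Gamma$, one has $\kappa(b_m,b_ib_j)=\kappa(b_i,b_m\overline{b_j})$ for all $i,j,m$. **Tabular algebras with trace.** Let $\mathcal A=\mathbb Z[v,v^{-1}]$, $\mathcal A^-=\mathbb Z[v^{-1}]$. For an $\mathcal A$-algebra $A$ with $\mathcal A$-basis $\mathbf B$, write $XY=\sum_{Z\in\mathbf B} g_{X,Y,Z}Z$ for $X,Y\in\mathbf B$ and $\mathbf a(Z)=\max_{X,Y\in\mathbf B}\deg g_{X,Y,Z}$, where $\deg$ is the highest power of $v$ occurring with nonzero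 coefficient; $\gamma_{X,Y,Z}\in\mathbb Z$ is the coefficient of $v^{\mathbf a(Z)}$ in $g_{X,Y,Z}$. A tabular algebra is an $\mathcal A$-algebra $A$ with a table datum $(\Lambda,\Gamma,B,M,C,* )$ satisfying (A1)–(A3); a tabular algebra with trace also satisfies (A4), (A5). (A1) $\Lambda$ is a finite poset; for each $\lambda\in\Lambda$, $(\Gamma(\lambda),B(\lambda))$ is a normalized table algebra over $\mathbb Z$ and $M(\lambda)$ is a nonempty finite set. The map $C:\coprod_{\lambda\in\Lambda}(M(\lambda)\times B(\lambda)\times M(\lambda))\to A$ is injective with image an $\mathcal A$-basis of $A$ (the tabular basis $\mathbf B=\operatorname{Im}(C)$). $\operatorname{Im}(C)$ contains a set of mutually orthogonal idempotents $\{1_\varepsilon:\varepsilon\in\mathcal E\}$ with $A=\sum_{\varepsilon,\varepsilon'}1_\varepsilon A1_{\varepsilon'}$ and such that each $X\in\operatorname{Im}(C)$ satisfies $X=1_\varepsilon X1_{\varepsilon'}$ for some $\varepsilon,\varepsilon'\in\mathcal E$. (A2) Write $C_{S,T}^b=C(S,b,T)$ for $S,T\in M(\lambda)$, $b\in B(\lambda)$. Then $*$ is an $\mathcal A$-linear involutory anti-automorphism of $A$ with $(C_{S,T}^b)^*=C_{T,S}^{\bar b}$. For $g=\sum c_ib_i$ ($b_i\in B(\lambda)$, $c_i$ scalars) put $C_{S,T}^g=\sum c_iC_{S,T}^{b_i}$. Write $\mathbf c_\lambda=C(M(\lambda)\times B(\lambda)\times M(\lambda))$. (A3) For $\lambda\in\Lambda$,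 $g\in\Gamma(\lambda)$, $S,T\in M(\lambda)$ and all $a\in A$: $a\,C_{S,T}^g\equiv\sum_{S'\in M(\lambda)}C_{S',T}^{r_a(S',S)g} \bmod A(<\lambda)$, where $r_a(S',S)\in\mathcal A\otimes_{\mathbb Z}\Gamma(\lambda)$ is independent of $T$ and $g$, and $A(<\lambda)$ is the $\mathcal A$-span of $\bigcup_{\mu<\lambda}\mathbf c_\mu$. (A4) Let $K=C_{S,T}^b$, $K'=C_{U,V}^{b'}$, $K''=C_{X,Y}^{b''}$. Then $\deg g_{K,K',K''}=\mathbf a(K'')$ if and only if $X=S$, $T=U$, $Y=V$ (in particular, all belong to the same $\lambda$) and $\kappa(b'',bb')\neq0$. If these hold and $b=b'=b''=1$, then $\gamma_{K,K',K''}=1$. (A5) There is an $\mathcal A$-linear $\tau:A\to\mathcal A$ (the tabular trace) with $\tau(x)=\tau(x^* )$, $\tau(xy)=\tau(yx)$, such that for $X=C_{S,T}^b$, $\tau(v^{\mathbf a(X)}X)$ is congruent mod $v^{-1}\mathcal A^-$ to $1$ if $S=T$ and $b=1$, and to $0$ otherwise. **Reduced.** A table datum is reduced if there is no strictly coarser partial order $\leq'$ on the set $\Lambda$ (i.e. $\leq$ is a proper refinement of $\leq'$) such that replacing $\leq$ by $\leq'$ still gives a table datum for $A$. A tabular algebra with a reduced table datum is called reduced. **The category $\mathcal D(A,\mathbf B)=\mathcal D(A,\mathbf B,\tau)$.** Objects: all $(\Lambda,\Gamma,B,M,* )$ for which there exists $C$ such that $(\Lambda,\Gamma,B,M,C,*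 )$ is a reduced table datum for $A$ (satisfying (A1)–(A5) with tabular trace $\tau$) with $\operatorname{Im}(C)=\mathbf B$. Morphisms $(\Lambda,\Gamma,B,M,* )\to(\Lambda',\Gamma',B',M',*')$: fix one map $C$ such that $(\Lambda,\Gamma,B,M,C,* )$ is a reduced table datum for $A$ (with trace $\tau$) with $\operatorname{Im}(C)=\mathbf B$; the morphisms are all maps $(C')^{-1}\circ C:\coprod_{\lambda\in\Lambda}(M(\lambda)\times B(\lambda)\times M(\lambda))\to\coprod_{\lambda'\in\Lambda'}(M'(\lambda')\times B'(\lambda')\times M'(\lambda'))$, where $C'$ ranges over all maps such that $(\Lambda',\Gamma',B',M',C',*')$ is a reduced table datum for $A$ (with trace $\tau$) with $\operatorname{Im}(C')=\mathbf B$. Composition is composition of maps. (This is well defined: the set of morphisms does not depend on the choice of $C$.) *)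

theory Defs
  imports Complex_Main "HOL-Library.Poly_Mapping" "HOL-Library.FuncSet" "HOL-Algebra.Ring"
begin

section \<open>Laurent polynomials over the integers\<close>

text \<open>
  The ring of Laurent polynomials in v with integer coefficients is the group ring of the additive
  group of integers: finitely supported functions with convolution product, the exponent of v
  being the argument.
\<close>

type_synonym laurent = "int \<Rightarrow>\<^sub>0 int"

definition vpow :: "int \<Rightarrow> laurent" where
  "vpow n = Poly_Mapping.single n 1"

text \<open>Only meaningful for nonzero arguments; the degree of 0 is regarded as minus infinity, so
  every use below is guarded by a nonvanishing condition.\<close>

definition ldeg :: "laurent \<Rightarrow> int" where
  "ldeg p = Max (Poly_Mapping.keys p)"

definition Aminus :: "laurent set" where
  "Aminus = {p. \<forall>n\<in>Poly_Mapping.keys p. n \<le> 0}"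

definition vinv_Aminus :: "laurent set" where
  "vinv_Aminus = (\<lambda>p. vpow (- 1) * p) ` Aminus"


section \<open>Algebras over the Laurent polynomials\<close>

text \<open>No identity element is required: the idempotent axiom of table data provides local units.\<close>

definition laurent_algebra :: "(laurent \<Rightarrow> 'a::ring \<Rightarrow> 'a) \<Rightarrow> bool" where
  "laurent_algebra scale \<longleftrightarrow>
     Modules.module scale \<and>
     (\<forall>c x y. scale c x * y = scale c (x * y) \<and> x * scale c y = scale c (x * y))"

definition algebra_automorphism :: "(laurent \<Rightarrow> 'a::ring \<Rightarrow> 'a) \<Rightarrow> ('a \<Rightarrow> 'a) \<Rightarrow> bool" where
  "algebra_automorphism scale f \<longleftrightarrow>
     module_hom scale scale f \<and> (\<forall>x y. f (x * y) = f x * f y) \<and> bij f"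

definition involutory_antiautomorphism ::
    "(laurent \<Rightarrow> 'a::ring \<Rightarrow> 'a) \<Rightarrow> ('a \<Rightarrow> 'a) \<Rightarrow> bool" where
  "involutory_antiautomorphism scale f \<longleftrightarrow>
     module_hom scale scale f \<and> (\<forall>x y. f (x * y) = f y * f x) \<and> (\<forall>x. f (f x) = x)"


section \<open>Normalized table algebras over the integers\<close>

definition int_basis :: "'g ring \<Rightarrow> 'g set \<Rightarrow> bool" where
  "int_basis R B \<longleftrightarrow> B \<subseteq> carrier R \<and>
     (\<forall>a\<in>carrier R. \<exists>!c::'g \<Rightarrow>\<^sub>0 int. Poly_Mapping.keys c \<subseteq> B \<and>
        a = (\<Oplus>\<^bsub>R\<^esub>b\<in>Poly_Mapping.keys c. [Poly_Mapping.lookup c b] \<cdot>\<^bsub>R\<^esub> b))"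

definition coords :: "'g ring \<Rightarrow> 'g set \<Rightarrow> 'g \<Rightarrow> ('g \<Rightarrow>\<^sub>0 int)" where
  "coords R B a = (THE c. Poly_Mapping.keys c \<subseteq> B \<and>
     a = (\<Oplus>\<^bsub>R\<^esub>b\<in>Poly_Mapping.keys c. [Poly_Mapping.lookup c b] \<cdot>\<^bsub>R\<^esub> b))"

definition kappa :: "'g ring \<Rightarrow> 'g set \<Rightarrow> 'g \<Rightarrow> 'g \<Rightarrow> int" where
  "kappa R B b a = Poly_Mapping.lookup (coords R B a) b"

definition table_involution :: "'g ring \<Rightarrow> 'g set \<Rightarrow> ('g \<Rightarrow> 'g) \<Rightarrow> bool" where
  "table_involution R B f \<longleftrightarrow>
     f \<in> carrier R \<rightarrow> carrier R \<and>
     (\<forall>x\<in>carrier R. \<forall>y\<in>carrier R. f (x \<oplus>\<^bsub>R\<^esub> y) = f x \<oplus>\<^bsub>R\<^esub> f y) \<and>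
     (\<forall>x\<in>carrier R. \<forall>y\<in>carrier R. f (x \<otimes>\<^bsub>R\<^esub> y) = f y \<otimes>\<^bsub>R\<^esub> f x) \<and>
     (\<forall>x\<in>carrier R. f (f x) = x) \<and>
     f ` B \<subseteq> B \<and>
     (\<forall>bi\<in>B. \<forall>bj\<in>B. \<forall>bm\<in>B.
        kappa R B bm (bi \<otimes>\<^bsub>R\<^esub> bj) = kappa R B bi (bm \<otimes>\<^bsub>R\<^esub> f bj))"

definition normalized_table_algebra :: "'g ring \<Rightarrow> 'g set \<Rightarrow> bool" where
  "normalized_table_algebra R B \<longleftrightarrow>
     Ring.ring R \<and> int_basis R B \<and> \<one>\<^bsub>R\<^esub> \<in> B \<and>
     (\<forall>bi\<in>B. \<forall>bj\<in>B. \<forall>bm\<in>B. kappa R B bm (bi \<otimes>\<^bsub>R\<^esub> bj) \<ge> 0) \<and>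
     (\<exists>f. table_involution R B f)"

text \<open>
  In a normalized table algebra the involution is unique on the carrier: taking bm = 1 above gives
  kappa 1 (bi bj) = 1 if bi is the image of bj and 0 for all other bi in B.
\<close>

definition tbar :: "'g ring \<Rightarrow> 'g set \<Rightarrow> 'g \<Rightarrow> 'g" where
  "tbar R B = (SOME f. table_involution R B f)"

text \<open>
  As B is an integral basis of R, the scalar extension of R to Laurent polynomials is the free
  module on B. Its elements are represented by finitely supported functions with support in B;
  its product is the bilinear extension of the product of R.
\<close>

definition ext_carrier :: "'g set \<Rightarrow> ('g \<Rightarrow>\<^sub>0 laurent) set" where
  "ext_carrier B = {x. Poly_Mapping.keys x \<subseteq> B}"

definition ext_embed :: "'g ring \<Rightarrow> 'g set \<Rightarrow> 'g \<Rightarrow> ('g \<Rightarrow>\<^sub>0 laurent)" where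
  "ext_embed R B g = Poly_Mapping.map of_int (coords R B g)"

definition ext_mult ::
    "'g ring \<Rightarrow> 'g set \<Rightarrow> ('g \<Rightarrow>\<^sub>0 laurent) \<Rightarrow> ('g \<Rightarrow>\<^sub>0 laurent) \<Rightarrow> ('g \<Rightarrow>\<^sub>0 laurent)" where
  "ext_mult R B x y =
     (\<Sum>b\<in>Poly_Mapping.keys x. \<Sum>b'\<in>Poly_Mapping.keys y.
        Poly_Mapping.map (\<lambda>k. Poly_Mapping.lookup x b * Poly_Mapping.lookup y b' * of_int k)
          (coords R B (b \<otimes>\<^bsub>R\<^esub> b')))"


section \<open>Table data\<close>

text \<open>
  A table datum without the map C. The order is a set of pairs (l, l') meaning l is below or
  equal to l'. Values of the families outside the index set are irrelevant.
\<close>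

record ('l, 'g, 'm, 'a) table_object =
  index_set :: "'l set"
  index_le :: "('l \<times> 'l) set"
  table_alg :: "'l \<Rightarrow> 'g ring"
  table_basis :: "'l \<Rightarrow> 'g set"
  mat_index :: "'l \<Rightarrow> 'm set"
  star :: "'a \<Rightarrow> 'a"

definition cell_dom :: "('l, 'g, 'm, 'a) table_object \<Rightarrow> 'l \<Rightarrow> ('l \<times> 'm \<times> 'g \<times> 'm) set" where
  "cell_dom D l = {l} \<times> mat_index D l \<times> table_basis D l \<times> mat_index D l"

definition triples :: "('l, 'g, 'm, 'a) table_object \<Rightarrow> ('l \<times> 'm \<times> 'g \<times> 'm) set" where
  "triples D = (\<Union>l\<in>index_set D. cell_dom D l)"

definition idempotent_condition ::
    "(laurent \<Rightarrow> 'a::ring \<Rightarrow> 'a) \<Rightarrow> 'a set \<Rightarrow> bool" where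
  "idempotent_condition scale BB \<longleftrightarrow>
     (\<exists>E\<subseteq>BB. (\<forall>e\<in>E. e * e = e) \<and> (\<forall>e\<in>E. \<forall>e'\<in>E. e \<noteq> e' \<longrightarrow> e * e' = 0) \<and>
        Modules.module.span scale (\<Union>e\<in>E. \<Union>e'\<in>E. range (\<lambda>x. e * x * e')) = UNIV \<and>
        (\<forall>X\<in>BB. \<exists>e\<in>E. \<exists>e'\<in>E. X = e * X * e'))"

definition axiom_A1 ::
    "(laurent \<Rightarrow> 'a::ring \<Rightarrow> 'a) \<Rightarrow> ('l, 'g, 'm, 'a) table_object \<Rightarrow>
     ('l \<times> 'm \<times> 'g \<times> 'm \<Rightarrow> 'a) \<Rightarrow> bool" where
  "axiom_A1 scale D C \<longleftrightarrow>
     finite (index_set D) \<and> partial_order_on (index_set D) (index_le D) \<and>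
     (\<forall>l\<in>index_set D. normalized_table_algebra (table_alg D l) (table_basis D l) \<and>
        finite (mat_index D l) \<and> mat_index D l \<noteq> {}) \<and>
     inj_on C (triples D) \<and>
     \<not> Modules.module.dependent scale (C ` triples D) \<and>
     Modules.module.span scale (C ` triples D) = UNIV \<and>
     idempotent_condition scale (C ` triples D)"

definition axiom_A2 ::
    "(laurent \<Rightarrow> 'a::ring \<Rightarrow> 'a) \<Rightarrow> ('l, 'g, 'm, 'a) table_object \<Rightarrow>
     ('l \<times> 'm \<times> 'g \<times> 'm \<Rightarrow> 'a) \<Rightarrow> bool" where
  "axiom_A2 scale D C \<longleftrightarrow>
     involutory_antiautomorphism scale (star D) \<and>
     (\<forall>l\<in>index_set D. \<forall>S\<in>mat_index D l. \<forall>T\<in>mat_index D l. \<forall>b\<in>table_basis D l.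
        star D (C (l, S, b, T)) = C (l, T, tbar (table_alg D l) (table_basis D l) b, S))"

definition C_ext ::
    "(laurent \<Rightarrow> 'a::ring \<Rightarrow> 'a) \<Rightarrow> ('l \<times> 'm \<times> 'g \<times> 'm \<Rightarrow> 'a) \<Rightarrow>
     'l \<Rightarrow> 'm \<Rightarrow> ('g \<Rightarrow>\<^sub>0 laurent) \<Rightarrow> 'm \<Rightarrow> 'a" where
  "C_ext scale C l S x T =
     (\<Sum>b\<in>Poly_Mapping.keys x. scale (Poly_Mapping.lookup x b) (C (l, S, b, T)))"

definition A_below ::
    "(laurent \<Rightarrow> 'a::ring \<Rightarrow> 'a) \<Rightarrow> ('l, 'g, 'm, 'a) table_object \<Rightarrow>
     ('l \<times> 'm \<times> 'g \<times> 'm \<Rightarrow> 'a) \<Rightarrow> 'l \<Rightarrow> 'a set" where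
  "A_below scale D C l =
     Modules.module.span scale
       (\<Union>k\<in>{k \<in> index_set D. (k, l) \<in> index_le D \<and> k \<noteq> l}. C ` cell_dom D k)"

definition axiom_A3 ::
    "(laurent \<Rightarrow> 'a::ring \<Rightarrow> 'a) \<Rightarrow> ('l, 'g, 'm, 'a) table_object \<Rightarrow>
     ('l \<times> 'm \<times> 'g \<times> 'm \<Rightarrow> 'a) \<Rightarrow> bool" where
  "axiom_A3 scale D C \<longleftrightarrow>
     (\<forall>l\<in>index_set D. \<forall>a. \<exists>r. 
        (\<forall>S'\<in>mat_index D l. \<forall>S\<in>mat_index D l. r S' S \<in> ext_carrier (table_basis D l)) \<and>
        (\<forall>S\<in>mat_index D l. \<forall>T\<in>mat_index D l. \<forall>g\<in>carrier (table_alg D l).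
           let gx = ext_embed (table_alg D l) (table_basis D l) g in
           a * C_ext scale C l S gx T
             - (\<Sum>S'\<in>mat_index D l.
                  C_ext scale C l S' (ext_mult (table_alg D l) (table_basis D l) (r S' S) gx) T)
           \<in> A_below scale D C l))"

definition table_datum ::
    "(laurent \<Rightarrow> 'a::ring \<Rightarrow> 'a) \<Rightarrow> ('l, 'g, 'm, 'a) table_object \<Rightarrow>
     ('l \<times> 'm \<times> 'g \<times> 'm \<Rightarrow> 'a) \<Rightarrow> bool" where
  "table_datum scale D C \<longleftrightarrow> axiom_A1 scale D C \<and> axiom_A2 scale D C \<and> axiom_A3 scale D C"

text \<open>A strictly coarser order is one with fewer relations.\<close>

definition reduced ::
    "(laurent \<Rightarrow> 'a::ring \<Rightarrow> 'a) \<Rightarrow> ('l, 'g, 'm, 'a) table_object \<Rightarrow>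
     ('l \<times> 'm \<times> 'g \<times> 'm \<Rightarrow> 'a) \<Rightarrow> bool" where
  "reduced scale D C \<longleftrightarrow>
     \<not> (\<exists>r. partial_order_on (index_set D) r \<and> r \<subset> index_le D \<and>
          table_datum scale (D\<lparr>index_le := r\<rparr>) C)"


section \<open>Table data with trace\<close>

definition strc :: "(laurent \<Rightarrow> 'a::ring \<Rightarrow> 'a) \<Rightarrow> 'a set \<Rightarrow> 'a \<Rightarrow> 'a \<Rightarrow> 'a \<Rightarrow> laurent" where
  "strc scale BB X Y Z = Modules.module.representation scale BB (X * Y) Z"

definition strc_degrees :: "(laurent \<Rightarrow> 'a::ring \<Rightarrow> 'a) \<Rightarrow> 'a set \<Rightarrow> 'a \<Rightarrow> int set" where
  "strc_degrees scale BB Z =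
     {ldeg (strc scale BB X Y Z) | X Y. X \<in> BB \<and> Y \<in> BB \<and> strc scale BB X Y Z \<noteq> 0}"

text \<open>The basis may be infinite, so that the maximum defining the a-function need not exist in
  general; its existence is part of the notion of a table datum with trace.\<close>

definition a_exists :: "(laurent \<Rightarrow> 'a::ring \<Rightarrow> 'a) \<Rightarrow> 'a set \<Rightarrow> bool" where
  "a_exists scale BB \<longleftrightarrow>
     (\<forall>Z\<in>BB. \<exists>n\<in>strc_degrees scale BB Z. \<forall>m\<in>strc_degrees scale BB Z. m \<le> n)"

definition a_fun :: "(laurent \<Rightarrow> 'a::ring \<Rightarrow> 'a) \<Rightarrow> 'a set \<Rightarrow> 'a \<Rightarrow> int" where
  "a_fun scale BB Z = (GREATEST n. n \<in> strc_degrees scale BB Z)"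

definition gamma :: "(laurent \<Rightarrow> 'a::ring \<Rightarrow> 'a) \<Rightarrow> 'a set \<Rightarrow> 'a \<Rightarrow> 'a \<Rightarrow> 'a \<Rightarrow> int" where
  "gamma scale BB X Y Z = Poly_Mapping.lookup (strc scale BB X Y Z) (a_fun scale BB Z)"

definition axiom_A4 ::
    "(laurent \<Rightarrow> 'a::ring \<Rightarrow> 'a) \<Rightarrow> ('l, 'g, 'm, 'a) table_object \<Rightarrow>
     ('l \<times> 'm \<times> 'g \<times> 'm \<Rightarrow> 'a) \<Rightarrow> bool" where
  "axiom_A4 scale D C \<longleftrightarrow>
     (\<forall>(l, S, b, T) \<in> triples D. \<forall>(l', U, b', V) \<in> triples D. \<forall>(l'', X, b'', Y) \<in> triples D.
        let BB = C ` triples D;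
            K = C (l, S, b, T); K' = C (l', U, b', V); K'' = C (l'', X, b'', Y);
            R = table_alg D l;
            match = (l = l' \<and> l = l'' \<and> X = S \<and> T = U \<and> Y = V \<and>
                     kappa R (table_basis D l) b'' (b \<otimes>\<^bsub>R\<^esub> b') \<noteq> 0)
        in ((strc scale BB K K' K'' \<noteq> 0 \<and> ldeg (strc scale BB K K' K'') = a_fun scale BB K'')
              \<longleftrightarrow> match) \<and>
           (match \<and> b = \<one>\<^bsub>R\<^esub> \<and> b' = \<one>\<^bsub>R\<^esub> \<and> b'' = \<one>\<^bsub>R\<^esub> \<longrightarrow> gamma scale BB K K' K'' = 1))"

definition axiom_A5 ::
    "(laurent \<Rightarrow> 'a::ring \<Rightarrow> 'a) \<Rightarrow> ('a \<Rightarrow> laurent) \<Rightarrow> ('l, 'g, 'm, 'a) table_object \<Rightarrow>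
     ('l \<times> 'm \<times> 'g \<times> 'm \<Rightarrow> 'a) \<Rightarrow> bool" where
  "axiom_A5 scale \<tau> D C \<longleftrightarrow>
     module_hom scale (*) \<tau> \<and>
     (\<forall>x. \<tau> x = \<tau> (star D x)) \<and> (\<forall>x y. \<tau> (x * y) = \<tau> (y * x)) \<and>
     (\<forall>(l, S, b, T) \<in> triples D.
        let X = C (l, S, b, T) in
        \<tau> (scale (vpow (a_fun scale (C ` triples D) X)) X)
          - (if S = T \<and> b = \<one>\<^bsub>table_alg D l\<^esub> then 1 else 0) \<in> vinv_Aminus)"

definition reduced_trace_datum ::
    "(laurent \<Rightarrow> 'a::ring \<Rightarrow> 'a) \<Rightarrow> ('a \<Rightarrow> laurent) \<Rightarrow> 'a set \<Rightarrow>
     ('l, 'g, 'm, 'a) table_object \<Rightarrow> ('l \<times> 'm \<times> 'g \<times> 'm \<Rightarrow> 'a) \<Rightarrow> bool" where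
  "reduced_trace_datum scale \<tau> BB D C \<longleftrightarrow>
     table_datum scale D C \<and> reduced scale D C \<and>
     a_exists scale (C ` triples D) \<and> axiom_A4 scale D C \<and> axiom_A5 scale \<tau> D C \<and>
     C ` triples D = BB"


section \<open>The category of reduced table data\<close>

definition cat_objects ::
    "(laurent \<Rightarrow> 'a::ring \<Rightarrow> 'a) \<Rightarrow> ('a \<Rightarrow> laurent) \<Rightarrow> 'a set \<Rightarrow>
     ('l, 'g, 'm, 'a) table_object set" where
  "cat_objects scale \<tau> BB = {D. \<exists>C. reduced_trace_datum scale \<tau> BB D C}"

definition fixed_C ::
    "(laurent \<Rightarrow> 'a::ring \<Rightarrow> 'a) \<Rightarrow> ('a \<Rightarrow> laurent) \<Rightarrow> 'a set \<Rightarrow>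
     ('l, 'g, 'm, 'a) table_object \<Rightarrow> ('l \<times> 'm \<times> 'g \<times> 'm \<Rightarrow> 'a)" where
  "fixed_C scale \<tau> BB D = (SOME C. reduced_trace_datum scale \<tau> BB D C)"

text \<open>Maps with domain the indexing triples are represented as extensional functions.\<close>

definition cat_hom ::
    "(laurent \<Rightarrow> 'a::ring \<Rightarrow> 'a) \<Rightarrow> ('a \<Rightarrow> laurent) \<Rightarrow> 'a set \<Rightarrow>
     ('l, 'g, 'm, 'a) table_object \<Rightarrow> ('k, 'h, 'n, 'a) table_object \<Rightarrow>
     ('l \<times> 'm \<times> 'g \<times> 'm \<Rightarrow> 'k \<times> 'n \<times> 'h \<times> 'n) set" where
  "cat_hom scale \<tau> BB D D' =
     {compose (triples D) (inv_into (triples D') C') (fixed_C scale \<tau> BB D) | C'.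
        reduced_trace_datum scale \<tau> BB D' C'}"

definition cat_automorphism ::
    "(laurent \<Rightarrow> 'a::ring \<Rightarrow> 'a) \<Rightarrow> ('a \<Rightarrow> laurent) \<Rightarrow> 'a set \<Rightarrow>
     ('l, 'g, 'm, 'a) table_object \<Rightarrow>
     ('l \<times> 'm \<times> 'g \<times> 'm \<Rightarrow> 'l \<times> 'm \<times> 'g \<times> 'm) \<Rightarrow> bool" where
  "cat_automorphism scale \<tau> BB D \<theta> \<longleftrightarrow>
     D \<in> cat_objects scale \<tau> BB \<and> \<theta> \<in> cat_hom scale \<tau> BB D D \<and>
     (\<exists>\<psi>\<in>cat_hom scale \<tau> BB D D.
        compose (triples D) \<psi> \<theta> = restrict id (triples D) \<and>
        compose (triples D) \<theta> \<psi> = restrict id (triples D))"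

end

theory Submission
  imports Defs
begin

text \<open>
  Leading coefficients of the structure constants of the tabular basis turn out to be the
  structure constants \<open>\<kappa>\<close> of the table algebras: by (A3) with \<open>g = 1\<close> the coefficients of \<open>r\<^sub>a\<close> are
  structure constants of the algebra, and comparing degrees via (A4) shows that the \<open>a\<close>-function is
  constant on cells and that \<open>\<gamma>\<close> is \<open>\<kappa>\<close> up to a factor which the involution identifies with the
  value 1 prescribed in (A4). An automorphism permuting the basis preserves \<open>\<gamma>\<close>, so the induced
  permutation \<open>\<theta>\<close> of the triples preserves the asymptotic structure constants, and hence all that is
  determined by them: the cells, the elements \<open>(S, 1, S)\<close> and the involution. Axiom (A3) is itself a
  condition on the basis, the cell order and these constants, and in a reduced datum the order is
  generated by the left action of the algebra, so \<open>\<theta>\<close> respects it. Therefore precomposing any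
  reduced datum with \<open>\<theta>\<close> or its inverse gives a reduced datum again.
\<close>

section \<open>Table algebras\<close>

lemma kappa_basis:
  assumes "normalized_table_algebra R B" "b \<in> B"
  shows "coords R B b = Poly_Mapping.single b 1" "kappa R B b' b = (if b' = b then 1 else 0)"
proof -
  interpret R: ring R using assms unfolding normalized_table_algebra_def by blast
  have ib: "int_basis R B" using assms unfolding normalized_table_algebra_def by blast
  have b: "b \<in> carrier R" using ib assms(2) unfolding int_basis_def by blast
  have "Poly_Mapping.keys (Poly_Mapping.single b (1::int)) \<subseteq> B \<and>
    b = (\<Oplus>\<^bsub>R\<^esub>x\<in>Poly_Mapping.keys (Poly_Mapping.single b (1::int)).
          [Poly_Mapping.lookup (Poly_Mapping.single b (1::int)) x] \<cdot>\<^bsub>R\<^esub> x)"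
    using assms(2) b by simp
  then show *: "coords R B b = Poly_Mapping.single b 1"
    unfolding coords_def
    by (rule the1_equality[OF bspec[OF conjunct2[OF ib[unfolded int_basis_def]] b]])
  show "kappa R B b' b = (if b' = b then 1 else 0)"
    unfolding kappa_def * by (simp add: lookup_single when_def)
qed

lemma keys_coords_subset:
  assumes "normalized_table_algebra R B" "x \<in> carrier R"
  shows "Poly_Mapping.keys (coords R B x) \<subseteq> B"
proof -
  have "\<exists>!c::'a \<Rightarrow>\<^sub>0 int. Poly_Mapping.keys c \<subseteq> B \<and>
        x = (\<Oplus>\<^bsub>R\<^esub>b\<in>Poly_Mapping.keys c. [Poly_Mapping.lookup c b] \<cdot>\<^bsub>R\<^esub> b)"
    using assms unfolding normalized_table_algebra_def int_basis_def by blast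
  from theI'[OF this] show ?thesis unfolding coords_def by blast
qed

lemma table_basis_facts:
  assumes "normalized_table_algebra R B"
  shows table_one_in: "\<one>\<^bsub>R\<^esub> \<in> B"
    and table_basis_carrier: "B \<subseteq> carrier R"
    and tbar_involution: "table_involution R B (tbar R B)"
proof -
  have "\<exists>f. table_involution R B f" using assms unfolding normalized_table_algebra_def by blast
  then show "table_involution R B (tbar R B)" unfolding tbar_def by (rule someI_ex)
qed (use assms in \<open>simp_all add: normalized_table_algebra_def int_basis_def\<close>)

lemma table_mult_carrier:
  assumes "normalized_table_algebra R B" "b \<in> B" "b' \<in> B"
  shows "b \<otimes>\<^bsub>R\<^esub> b' \<in> carrier R"
proof -
  interpret R: ring R using assms unfolding normalized_table_algebra_def by blast
  show ?thesis using assms(2,3) table_basis_carrier[OF assms(1)] by (intro R.m_closed) auto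
qed

lemma kappa_mult_one:
  assumes nta: "normalized_table_algebra R B" and b: "b \<in> B"
  shows "kappa R B b' (b \<otimes>\<^bsub>R\<^esub> \<one>\<^bsub>R\<^esub>) = (if b' = b then 1 else 0)"
    and "kappa R B b' (\<one>\<^bsub>R\<^esub> \<otimes>\<^bsub>R\<^esub> b) = (if b' = b then 1 else 0)"
proof -
  interpret R: ring R using nta unfolding normalized_table_algebra_def by blast
  have bc: "b \<in> carrier R" using table_basis_carrier[OF nta] b by auto
  show "kappa R B b' (b \<otimes>\<^bsub>R\<^esub> \<one>\<^bsub>R\<^esub>) = (if b' = b then 1 else 0)"
    unfolding R.r_one[OF bc] by (rule kappa_basis(2)[OF nta b])
  show "kappa R B b' (\<one>\<^bsub>R\<^esub> \<otimes>\<^bsub>R\<^esub> b) = (if b' = b then 1 else 0)"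
    unfolding R.l_one[OF bc] by (rule kappa_basis(2)[OF nta b])
qed

text \<open>For the last claim, (T3) with the unit as \<open>bm\<close> moves \<open>b'\<close> to
  the other side and leaves a coefficient of a single basis element. The bar is thereby
  characterized by structure constants, which later forces permutations preserving them to commute
  with it.\<close>

lemma tbar_facts:
  assumes nta: "normalized_table_algebra R B" and b: "b \<in> B"
  shows tbar_in: "tbar R B b \<in> B" and tbar_tbar: "tbar R B (tbar R B b) = b"
    and kappa_one: "\<And>b'. b' \<in> B \<Longrightarrow>
       kappa R B \<one>\<^bsub>R\<^esub> (b \<otimes>\<^bsub>R\<^esub> b') = (if b' = tbar R B b then 1 else 0)"
proof -
  let ?f = "tbar R B"
  have inv: "table_involution R B ?f" using tbar_involution[OF nta] .
  have f: "?f x \<in> B" "?f (?f x) = x" if "x \<in> B" for x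
  proof -
    have "x \<in> carrier R" using that table_basis_carrier[OF nta] by auto
    then show "?f (?f x) = x" using inv unfolding table_involution_def by simp
    have "?f ` B \<subseteq> B" using inv unfolding table_involution_def by simp
    then show "?f x \<in> B" using that by auto
  qed
  show "?f b \<in> B" "?f (?f b) = b" using f b by auto
  fix b' assume b': "b' \<in> B"
  have "kappa R B \<one>\<^bsub>R\<^esub> (b \<otimes>\<^bsub>R\<^esub> b') = kappa R B b (\<one>\<^bsub>R\<^esub> \<otimes>\<^bsub>R\<^esub> ?f b')"
    using inv b b' table_one_in[OF nta] unfolding table_involution_def by blast
  also have "\<dots> = (if b = ?f b' then 1 else 0)"
    using kappa_mult_one(2)[OF nta f(1)[OF b']] .
  also have "(b = ?f b') = (b' = ?f b)" using f b b' by metis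
  finally show "kappa R B \<one>\<^bsub>R\<^esub> (b \<otimes>\<^bsub>R\<^esub> b') = (if b' = ?f b then 1 else 0)" .
qed

text \<open>The unit occurs in its own square, so \<open>kappa_one\<close> leaves no other value for
  its bar.\<close>

lemma tbar_one:
  assumes nta: "normalized_table_algebra R B"
  shows "tbar R B \<one>\<^bsub>R\<^esub> = \<one>\<^bsub>R\<^esub>"
  using kappa_one[OF nta table_one_in[OF nta] table_one_in[OF nta]]
    kappa_mult_one[OF nta table_one_in[OF nta], of "\<one>\<^bsub>R\<^esub>"]
  by (metis zero_neq_one)

section \<open>The asymptotic structure constants of a table object\<close>

text \<open>These are the structure constants of the direct sum, over the cells, of matrix rings
  over the table algebras: \<open>(l, S, b, T)\<close> stands for \<open>b\<close> times the matrix
  unit in row \<open>S\<close> and column \<open>T\<close>.\<close>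

fun asymp_coeff :: "('l, 'g, 'm, 'a) table_object \<Rightarrow>
    'l \<times> 'm \<times> 'g \<times> 'm \<Rightarrow> 'l \<times> 'm \<times> 'g \<times> 'm \<Rightarrow> 'l \<times> 'm \<times> 'g \<times> 'm \<Rightarrow> int" where
  "asymp_coeff D (l, S, b, T) (l', U, b', V) (l'', X, b'', Y) =
     (if l = l' \<and> l = l'' \<and> X = S \<and> T = U \<and> Y = V
      then kappa (table_alg D l) (table_basis D l) b'' (b \<otimes>\<^bsub>table_alg D l\<^esub> b') else 0)"

text \<open>The diagonal matrix units, that is, the distinguished idempotents of the asymptotic
  ring; they are also the triples at which (A5) prescribes the residue 1.\<close>

fun diagonal :: "('l, 'g, 'm, 'a) table_object \<Rightarrow> 'l \<times> 'm \<times> 'g \<times> 'm \<Rightarrow> bool" where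
  "diagonal D (l, S, b, T) \<longleftrightarrow> S = T \<and> b = \<one>\<^bsub>table_alg D l\<^esub>"

fun left_unit :: "('l, 'g, 'm, 'a) table_object \<Rightarrow> 'l \<times> 'm \<times> 'g \<times> 'm \<Rightarrow> 'l \<times> 'm \<times> 'g \<times> 'm" where
  "left_unit D (l, S, b, T) = (l, S, \<one>\<^bsub>table_alg D l\<^esub>, S)"

text \<open>Transposition of matrix units combined with the bar on entries; by (A2) this is the
  effect of the star on triples.\<close>

fun flip :: "('l, 'g, 'm, 'a) table_object \<Rightarrow> 'l \<times> 'm \<times> 'g \<times> 'm \<Rightarrow> 'l \<times> 'm \<times> 'g \<times> 'm" where
  "flip D (l, S, b, T) = (l, T, tbar (table_alg D l) (table_basis D l) b, S)"

lemma in_triples [simp]: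
  "(l, S, b, T) \<in> triples D \<longleftrightarrow>
     l \<in> index_set D \<and> S \<in> mat_index D l \<and> b \<in> table_basis D l \<and> T \<in> mat_index D l"
  by (auto simp: triples_def cell_dom_def)

lemma fst_in_index_set: "t \<in> triples D \<Longrightarrow> fst t \<in> index_set D"
  by (auto simp: triples_def cell_dom_def)

definition table_family :: "('l, 'g, 'm, 'a) table_object \<Rightarrow> bool" where
  "table_family D \<longleftrightarrow>
     (\<forall>l\<in>index_set D. normalized_table_algebra (table_alg D l) (table_basis D l) \<and>
        mat_index D l \<noteq> {})"

lemma table_familyD:
  assumes "table_family D" "l \<in> index_set D"
  shows "normalized_table_algebra (table_alg D l) (table_basis D l)"
    and "\<one>\<^bsub>table_alg D l\<^esub> \<in> table_basis D l"
    and "\<And>b. b \<in> table_basis D l \<Longrightarrow> tbar (table_alg D l) (table_basis D l) b \<in> table_basis D l"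
proof -
  show *: "normalized_table_algebra (table_alg D l) (table_basis D l)"
    using assms by (simp add: table_family_def)
  show "\<one>\<^bsub>table_alg D l\<^esub> \<in> table_basis D l" by (rule table_one_in[OF *])
  show "tbar (table_alg D l) (table_basis D l) b \<in> table_basis D l"
    if "b \<in> table_basis D l" for b by (rule tbar_in[OF * that])
qed

lemma left_unit_in: "table_family D \<Longrightarrow> t \<in> triples D \<Longrightarrow> left_unit D t \<in> triples D"
  by (cases t) (simp add: table_familyD)

lemma flip_in: "table_family D \<Longrightarrow> t \<in> triples D \<Longrightarrow> flip D t \<in> triples D"
  by (cases t) (simp add: table_familyD)

text \<open>A diagonal triple acts from the left as a partial identity, so products never change the
  right factor. Conversely, right multiplication by the unit of its column returns \<open>t\<close>,
  which forces \<open>t\<close> to be that unit. The criterion speaks of coefficients only, hence is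
  invariant under bijections preserving them.\<close>

lemma diagonal_iff:
  assumes D: "table_family D" and t: "t \<in> triples D"
  shows "diagonal D t \<longleftrightarrow>
    (\<forall>y\<in>triples D. \<forall>z\<in>triples D. asymp_coeff D t y z \<noteq> 0 \<longrightarrow> y = z)"
proof -
  obtain l S b T where tt: "t = (l, S, b, T)" by (cases t)
  let ?o = "\<one>\<^bsub>table_alg D l\<^esub>"
  have l: "l \<in> index_set D" "S \<in> mat_index D l" "b \<in> table_basis D l" "T \<in> mat_index D l"
    using t tt by auto
  note F = table_familyD[OF D l(1)]
  show ?thesis
  proof
    assume "diagonal D t"
    then have t': "t = (l, S, ?o, S)" using tt by simp
    show "\<forall>y\<in>triples D. \<forall>z\<in>triples D. asymp_coeff D t y z \<noteq> 0 \<longrightarrow> y = z"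
    proof (intro ballI impI)
      fix y z assume y: "y \<in> triples D" and nz: "asymp_coeff D t y z \<noteq> 0"
      obtain l' U b' V where yy: "y = (l', U, b', V)" by (cases y)
      obtain m X b'' Y where zz: "z = (m, X, b'', Y)" by (cases z)
      have *: "l' = l" "m = l" "U = S" "X = S" "V = Y"
        using nz by (simp_all add: t' yy zz split: if_splits)
      moreover have "b' \<in> table_basis D l" using y * by (simp add: yy)
      ultimately show "y = z"
        using nz kappa_mult_one(2)[OF F(1)] by (simp add: t' yy zz split: if_splits)
    qed
  next
    assume *: "\<forall>y\<in>triples D. \<forall>z\<in>triples D. asymp_coeff D t y z \<noteq> 0 \<longrightarrow> y = z"
    have "asymp_coeff D t (l, T, ?o, T) t \<noteq> 0" using l F by (simp add: tt kappa_mult_one)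
    moreover have "(l, T, ?o, T) \<in> triples D" using l F by simp
    ultimately have "(l, T, ?o, T) = t" using * t by blast
    then show "diagonal D t" using tt by auto
  qed
qed

text \<open>A diagonal triple multiplies \<open>t\<close> nontrivially from the left only if it sits
  in the cell and row of \<open>t\<close>. Like \<open>diagonal_iff\<close>, this replaces explicit
  components by coefficients.\<close>

lemma left_unit_unique:
  assumes D: "table_family D" and t: "t \<in> triples D" and d: "d \<in> triples D"
  shows "d = left_unit D t \<longleftrightarrow> diagonal D d \<and> asymp_coeff D d t t \<noteq> 0"
proof -
  obtain l S b T where tt: "t = (l, S, b, T)" by (cases t)
  obtain l' S' b' T' where dd: "d = (l', S', b', T')" by (cases d)
  have l: "l \<in> index_set D" "b \<in> table_basis D l" using t tt by auto
  note F = table_familyD[OF D l(1)]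
  show ?thesis
  proof
    assume "d = left_unit D t"
    then show "diagonal D d \<and> asymp_coeff D d t t \<noteq> 0"
      using kappa_mult_one(2)[OF F(1) l(2)] by (simp add: tt)
  next
    assume "diagonal D d \<and> asymp_coeff D d t t \<noteq> 0"
    then show "d = left_unit D t" by (auto simp: tt dd split: if_splits)
  qed
qed

text \<open>A product hits the diagonal only if rows and columns are interchanged, and by
  \<open>kappa_one\<close> its entry then contains the unit exactly when the two entries are bars of
  each other.\<close>

lemma flip_unique:
  assumes D: "table_family D" and t: "t \<in> triples D" and y: "y \<in> triples D"
  shows "y = flip D t \<longleftrightarrow> (\<exists>d\<in>triples D. diagonal D d \<and> asymp_coeff D t y d \<noteq> 0)"
proof -
  obtain l S b T where tt: "t = (l, S, b, T)" by (cases t)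
  obtain l' U b' V where yy: "y = (l', U, b', V)" by (cases y)
  let ?o = "\<one>\<^bsub>table_alg D l\<^esub>"
  have l: "l \<in> index_set D" "S \<in> mat_index D l" "b \<in> table_basis D l" "T \<in> mat_index D l"
    using t tt by auto
  note F = table_familyD[OF D l(1)]
  show ?thesis
  proof
    assume "y = flip D t"
    then have "(l, S, ?o, S) \<in> triples D \<and> diagonal D (l, S, ?o, S) \<and> asymp_coeff D t y (l, S, ?o, S) \<noteq> 0"
      using l F by (simp add: tt kappa_one)
    then show "\<exists>d\<in>triples D. diagonal D d \<and> asymp_coeff D t y d \<noteq> 0" by blast
  next
    assume "\<exists>d\<in>triples D. diagonal D d \<and> asymp_coeff D t y d \<noteq> 0"
    then obtain d where d: "diagonal D d" "asymp_coeff D t y d \<noteq> 0" by blast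
    then have *: "l' = l" "U = T" "V = S" "fst d = l" "fst (snd (snd d)) = ?o"
      by (auto simp: tt yy split: if_splits elim!: diagonal.elims)
    then have "kappa (table_alg D l) (table_basis D l) ?o (b \<otimes>\<^bsub>table_alg D l\<^esub> b') \<noteq> 0"
      using d(2) by (cases d) (simp add: tt yy split: if_splits)
    moreover have "b' \<in> table_basis D l" using y yy * by simp
    ultimately show "y = flip D t"
      using kappa_one[OF F(1) l(3)] * by (simp add: tt yy split: if_splits)
  qed
qed

lemma asymp_nonzero_fst:
  "asymp_coeff D t y z \<noteq> 0 \<Longrightarrow> fst y = fst t \<and> fst z = fst t"
  by (cases t; cases y; cases z) (auto split: if_splits)

text \<open>The triple with row \<open>T\<close>, entry 1 and column \<open>U\<close> connects
  column \<open>T\<close> of \<open>t\<close> to row \<open>U\<close> of \<open>t'\<close>. The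
  detour is needed because \<open>t\<close> and \<open>t'\<close> compose directly only if
  \<open>T = U\<close>. Since nonzero coefficients never leave a cell, the partition into cells is
  determined by them.\<close>

lemma same_cell_link:
  assumes D: "table_family D" and "t \<in> triples D" "t' \<in> triples D" "fst t = fst t'"
  shows "\<exists>x\<in>triples D. \<exists>z\<in>triples D. \<exists>z'\<in>triples D. asymp_coeff D t x z \<noteq> 0 \<and> asymp_coeff D x t' z' \<noteq> 0"
proof -
  obtain l S b T where tt: "t = (l, S, b, T)" by (cases t)
  obtain U b' V where tt': "t' = (l, U, b', V)" using assms(4) tt by (cases t') auto
  let ?o = "\<one>\<^bsub>table_alg D l\<^esub>"
  have l: "l \<in> index_set D" using assms tt by auto
  note F = table_familyD[OF D l]
  have "asymp_coeff D t (l, T, ?o, U) (l, S, b, U) \<noteq> 0" "asymp_coeff D (l, T, ?o, U) t' (l, T, b', V) \<noteq> 0"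
    using assms(2,3) F by (simp_all add: tt tt' kappa_mult_one)
  moreover have "(l, T, ?o, U) \<in> triples D" "(l, S, b, U) \<in> triples D" "(l, T, b', V) \<in> triples D"
    using assms(2,3) F by (simp_all add: tt tt')
  ultimately show ?thesis by blast
qed

section \<open>Bijections of the triples that preserve the asymptotic structure constants\<close>

locale asymp_automorphism =
  fixes D :: "('l, 'g, 'm, 'a) table_object" and \<theta>
  assumes family: "table_family D"
    and bij: "bij_betw \<theta> (triples D) (triples D)"
    and asymp_eq: "\<And>t y z. t \<in> triples D \<Longrightarrow> y \<in> triples D \<Longrightarrow> z \<in> triples D \<Longrightarrow>
      asymp_coeff D (\<theta> t) (\<theta> y) (\<theta> z) = asymp_coeff D t y z"
begin

lemma in_triples_image: "t \<in> triples D \<Longrightarrow> \<theta> t \<in> triples D"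
  using bij by (auto simp: bij_betw_def)

lemma triples_imageE:
  assumes "t \<in> triples D" obtains y where "y \<in> triples D" "t = \<theta> y"
  using assms bij by (metis bij_betw_imp_surj_on imageE)

lemma ball_image: "(\<forall>t\<in>triples D. P t) \<longleftrightarrow> (\<forall>t\<in>triples D. P (\<theta> t))"
  using bij by (metis bij_betw_imp_surj_on imageE in_triples_image)

lemma eq_image: "t \<in> triples D \<Longrightarrow> y \<in> triples D \<Longrightarrow> \<theta> t = \<theta> y \<longleftrightarrow> t = y"
  using bij by (auto simp: bij_betw_def inj_on_def)

lemma diagonal_image:
  assumes "t \<in> triples D" shows "diagonal D (\<theta> t) \<longleftrightarrow> diagonal D t"
proof -
  \<comment> \<open>Surjectivity allows both quantified triples to be written as images, after which
    \<open>asymp_eq\<close> applies.\<close>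
  have "diagonal D (\<theta> t) \<longleftrightarrow>
    (\<forall>y\<in>triples D. \<forall>z\<in>triples D. asymp_coeff D (\<theta> t) (\<theta> y) (\<theta> z) \<noteq> 0 \<longrightarrow> \<theta> y = \<theta> z)"
    unfolding diagonal_iff[OF family in_triples_image[OF assms]]
    by (subst ball_image, rule ball_cong[OF refl], subst ball_image) simp
  also have "\<dots> \<longleftrightarrow> diagonal D t"
    unfolding diagonal_iff[OF family assms]
    by (intro ball_cong refl) (simp add: assms asymp_eq eq_image)
  finally show ?thesis .
qed

lemma left_unit_image:
  assumes "t \<in> triples D" shows "\<theta> (left_unit D t) = left_unit D (\<theta> t)"
proof -
  have u: "left_unit D t \<in> triples D" using left_unit_in[OF family assms] .
  have "diagonal D (left_unit D t) \<and> asymp_coeff D (left_unit D t) t t \<noteq> 0"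
    using left_unit_unique[OF family assms u] by blast
  then have "diagonal D (\<theta> (left_unit D t)) \<and> asymp_coeff D (\<theta> (left_unit D t)) (\<theta> t) (\<theta> t) \<noteq> 0"
    using assms u by (simp add: diagonal_image asymp_eq)
  then show ?thesis
    using left_unit_unique[OF family in_triples_image[OF assms] in_triples_image[OF u]] by blast
qed

lemma flip_image:
  assumes "t \<in> triples D" shows "\<theta> (flip D t) = flip D (\<theta> t)"
proof -
  have u: "flip D t \<in> triples D" using flip_in[OF family assms] .
  obtain d where "d \<in> triples D" "diagonal D d" "asymp_coeff D t (flip D t) d \<noteq> 0"
    using flip_unique[OF family assms u] by blast
  then have "\<theta> d \<in> triples D" "diagonal D (\<theta> d)" "asymp_coeff D (\<theta> t) (\<theta> (flip D t)) (\<theta> d) \<noteq> 0"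
    using assms u by (simp_all add: diagonal_image asymp_eq in_triples_image)
  then show ?thesis
    using flip_unique[OF family in_triples_image[OF assms] in_triples_image[OF u]] by blast
qed

lemma same_cell_image:
  assumes "t \<in> triples D" "t' \<in> triples D" "fst t = fst t'"
  shows "fst (\<theta> t) = fst (\<theta> t')"
proof -
  obtain x z z' where "x \<in> triples D" "z \<in> triples D" "z' \<in> triples D"
    "asymp_coeff D t x z \<noteq> 0" "asymp_coeff D x t' z' \<noteq> 0"
    using same_cell_link[OF family assms] by blast
  then have "asymp_coeff D (\<theta> t) (\<theta> x) (\<theta> z) \<noteq> 0" "asymp_coeff D (\<theta> x) (\<theta> t') (\<theta> z') \<noteq> 0"
    using assms by (simp_all add: asymp_eq)
  then show ?thesis using asymp_nonzero_fst by metis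
qed

lemma inverse_automorphism: "asymp_automorphism D (inv_into (triples D) \<theta>)"
proof
  let ?i = "inv_into (triples D) \<theta>"
  show "table_family D" by (rule family)
  show b: "bij_betw ?i (triples D) (triples D)" using bij by (rule bij_betw_inv_into)
  fix t y z assume a: "t \<in> triples D" "y \<in> triples D" "z \<in> triples D"
  have i: "?i x \<in> triples D" "\<theta> (?i x) = x" if "x \<in> triples D" for x
    using that bij b by (auto simp: bij_betw_def f_inv_into_f)
  show "asymp_coeff D (?i t) (?i y) (?i z) = asymp_coeff D t y z"
    using asymp_eq[OF i(1)[OF a(1)] i(1)[OF a(2)] i(1)[OF a(3)]] i(2) a by simp
qed

end

section \<open>Axiom (A3) in terms of the asymptotic structure constants\<close>

text \<open>Only triples in row \<open>S'\<close> and column \<open>S\<close> of cell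
  \<open>l\<close> have a nonzero coefficient here, and only if the outer columns agree. This links
  sums over all triples, which can be reindexed along a permutation, with sums over one table basis
  as they occur in (A3). Finiteness is assumed because table bases may be infinite.\<close>

lemma asymp_sum:
  fixes f :: "'l \<times> 'm \<times> 'g \<times> 'm \<Rightarrow> laurent" and D :: "('l, 'g, 'm, 'a) table_object"
  assumes fin: "finite {y \<in> triples D. f y \<noteq> 0}"
    and S: "l \<in> index_set D" "S \<in> mat_index D l" "S' \<in> mat_index D l"
  shows "(\<Sum>y\<in>{y \<in> triples D. f y \<noteq> 0}. f y * of_int (asymp_coeff D y (l, S, b, T) (l, S', b'', T'))) =
    (if T' = T then \<Sum>b'\<in>{b' \<in> table_basis D l. f (l, S', b', S) \<noteq> 0}.
       f (l, S', b', S) * of_int (kappa (table_alg D l) (table_basis D l) b'' (b' \<otimes>\<^bsub>table_alg D l\<^esub> b))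
     else 0)"
proof (cases "T' = T")
  case False
  have "asymp_coeff D y (l, S, b, T) (l, S', b'', T') = 0" for y
    using False by (cases y) simp
  then show ?thesis using False by simp
next
  case True
  let ?F = "{y \<in> triples D. f y \<noteq> 0}"
  let ?G = "{b' \<in> table_basis D l. f (l, S', b', S) \<noteq> 0}"
  let ?h = "\<lambda>b'. (l, S', b', S)"
  have sub: "?h ` ?G \<subseteq> ?F" using S by auto
  have "asymp_coeff D y (l, S, b, T) (l, S', b'', T') = 0" if "y \<in> ?F - ?h ` ?G" for y
    using that by (cases y) auto
  then have "(\<Sum>y\<in>?F. f y * of_int (asymp_coeff D y (l, S, b, T) (l, S', b'', T'))) =
    (\<Sum>y\<in>?h ` ?G. f y * of_int (asymp_coeff D y (l, S, b, T) (l, S', b'', T')))"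
    by (intro sum.mono_neutral_right fin sub ballI) simp
  also have "\<dots> = (\<Sum>b'\<in>?G. f (?h b') * of_int (asymp_coeff D (?h b') (l, S, b, T) (l, S', b'', T')))"
    by (subst sum.reindex) (auto simp: inj_on_def)
  finally show ?thesis using True by simp
qed

section \<open>Coordinates with respect to a basis over the Laurent polynomials\<close>

locale based_algebra =
  fixes scale :: "laurent \<Rightarrow> 'a::ring \<Rightarrow> 'a" and BB :: "'a set"
  assumes alg: "laurent_algebra scale"
    and indep: "\<not> Modules.module.dependent scale BB"
    and spans: "Modules.module.span scale BB = UNIV"
begin

sublocale module scale
  using alg unfolding laurent_algebra_def by blast

lemma mult_scale: "x * scale c y = scale c (x * y)"
  using alg unfolding laurent_algebra_def by blast

abbreviation rep :: "'a \<Rightarrow> 'a \<Rightarrow> laurent" where "rep \<equiv> representation BB"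

lemma rep_diff: "rep (x - y) Z = rep x Z - rep y Z"
  using representation_diff[OF indep] spans by simp

lemma rep_scale: "rep (scale c x) Z = c * rep x Z"
  using representation_scale[OF indep] spans by simp

lemma rep_sum: "rep (sum f I) Z = (\<Sum>i\<in>I. rep (f i) Z)"
  by (subst representation_sum[OF indep]) (simp_all add: spans)

lemma rep_basis: "Y \<in> BB \<Longrightarrow> rep Y Z = (if Z = Y then 1 else 0)"
  using representation_basis[OF indep] by simp

lemma in_span_iff:
  assumes "S \<subseteq> BB"
  shows "x \<in> span S \<longleftrightarrow> (\<forall>Z. rep x Z \<noteq> 0 \<longrightarrow> Z \<in> S)"
proof
  assume "x \<in> span S"
  then show "\<forall>Z. rep x Z \<noteq> 0 \<longrightarrow> Z \<in> S"
    using representation_extend[OF indep _ assms] representation_ne_zero by metis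
next
  assume *: "\<forall>Z. rep x Z \<noteq> 0 \<longrightarrow> Z \<in> S"
  have "(\<Sum>Z | rep x Z \<noteq> 0. scale (rep x Z) Z) \<in> span S"
    using * by (intro span_sum span_scale span_base) auto
  then show "x \<in> span S"
    using sum_nonzero_representation_eq[OF indep] spans by simp
qed

end

text \<open>A form of (A3) without the coefficients \<open>r\<^sub>a\<close>, which are recovered as the coordinates of
  \<open>a * C (l, S, 1, S)\<close>.\<close>

definition cell_action ::
    "(laurent \<Rightarrow> 'a::ring \<Rightarrow> 'a) \<Rightarrow> ('l, 'g, 'm, 'a) table_object \<Rightarrow>
     ('l \<times> 'm \<times> 'g \<times> 'm \<Rightarrow> 'a) \<Rightarrow> bool" where
  "cell_action scale D C \<longleftrightarrow>
     (let rep = Modules.module.representation scale (C ` triples D) in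
     \<forall>a. \<forall>t\<in>triples D. \<forall>z\<in>triples D.
       (rep (a * C t) (C z) \<noteq> 0 \<longrightarrow> (fst z, fst t) \<in> index_le D) \<and>
       (fst z = fst t \<longrightarrow>
          rep (a * C t) (C z) =
            (\<Sum>y\<in>{y \<in> triples D. rep (a * C (left_unit D t)) (C y) \<noteq> 0}.
               rep (a * C (left_unit D t)) (C y) * of_int (asymp_coeff D y t z))))"

section \<open>Coordinates in the scalar extension of a table algebra\<close>

lemma lookup_map_poly: "f 0 = 0 \<Longrightarrow> Poly_Mapping.lookup (Poly_Mapping.map f p) k = f (Poly_Mapping.lookup p k)"
  by (simp add: Poly_Mapping.map.rep_eq when_def)

lemma lookup_ext_embed:
  "Poly_Mapping.lookup (ext_embed R B g) b = of_int (kappa R B b g)"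
  unfolding ext_embed_def kappa_def by (subst lookup_map_poly) auto

lemma ext_embed_basis:
  assumes "normalized_table_algebra R B" "b \<in> B"
  shows "ext_embed R B b = Poly_Mapping.single b 1"
  by (rule poly_mapping_eqI) (simp add: lookup_ext_embed kappa_basis(2)[OF assms] lookup_single when_def)

lemma lookup_ext_mult:
  "Poly_Mapping.lookup (ext_mult R B x y) b =
     (\<Sum>b1\<in>Poly_Mapping.keys x. \<Sum>b2\<in>Poly_Mapping.keys y.
        Poly_Mapping.lookup x b1 * Poly_Mapping.lookup y b2 * of_int (kappa R B b (b1 \<otimes>\<^bsub>R\<^esub> b2)))"
  unfolding ext_mult_def lookup_sum kappa_def
  by (intro sum.cong refl, subst lookup_map_poly) auto

lemma kappa_nonzero_in:
  assumes "normalized_table_algebra R B" "x \<in> carrier R" "kappa R B b x \<noteq> 0"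
  shows "b \<in> B"
  using keys_coords_subset[OF assms(1,2)] assms(3) unfolding kappa_def
  by (auto simp: in_keys_iff)

lemma ext_mult_carrier:
  assumes nta: "normalized_table_algebra R B" and x: "x \<in> ext_carrier B" and y: "y \<in> ext_carrier B"
  shows "ext_mult R B x y \<in> ext_carrier B"
proof -
  have "b \<in> B" if "b \<in> Poly_Mapping.keys (ext_mult R B x y)" for b
  proof (rule ccontr)
    assume "b \<notin> B"
    then have "kappa R B b (b1 \<otimes>\<^bsub>R\<^esub> b2) = 0"
      if "b1 \<in> Poly_Mapping.keys x" "b2 \<in> Poly_Mapping.keys y" for b1 b2
      using kappa_nonzero_in[OF nta table_mult_carrier[OF nta]] that x y unfolding ext_carrier_def by blast
    then have "Poly_Mapping.lookup (ext_mult R B x y) b = 0"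
      unfolding lookup_ext_mult by (intro sum.neutral ballI) simp
    then show False using that by (simp add: in_keys_iff)
  qed
  then show ?thesis unfolding ext_carrier_def by blast
qed

lemma ext_embed_carrier:
  assumes "normalized_table_algebra R B" "g \<in> carrier R"
  shows "ext_embed R B g \<in> ext_carrier B"
  using kappa_nonzero_in[OF assms]
  by (auto simp: ext_carrier_def in_keys_iff lookup_ext_embed)

section \<open>(A3) as a condition on coordinates\<close>

locale table_setting = based_algebra scale BB for scale :: "laurent \<Rightarrow> 'a::ring \<Rightarrow> 'a" and BB +
  fixes D :: "('l, 'g, 'm, 'a) table_object" and C :: "'l \<times> 'm \<times> 'g \<times> 'm \<Rightarrow> 'a"
  assumes family: "table_family D"
    and finite_mat: "\<And>l. l \<in> index_set D \<Longrightarrow> finite (mat_index D l)"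
    and inj: "inj_on C (triples D)"
    and image: "C ` triples D = BB"
    and order: "partial_order_on (index_set D) (index_le D)"
begin

lemma C_in: "t \<in> triples D \<Longrightarrow> C t \<in> BB"
  using image by auto

lemma C_eq: "t \<in> triples D \<Longrightarrow> z \<in> triples D \<Longrightarrow> C t = C z \<longleftrightarrow> t = z"
  using inj by (auto dest: inj_onD)

lemma finite_support: "finite {y \<in> triples D. rep x (C y) \<noteq> 0}"
proof (rule inj_on_finite)
  show "inj_on C {y \<in> triples D. rep x (C y) \<noteq> 0}" using inj by (rule inj_on_subset) auto
  show "C ` {y \<in> triples D. rep x (C y) \<noteq> 0} \<subseteq> {Z. rep x Z \<noteq> 0}" by auto
  show "finite {Z. rep x Z \<noteq> 0}" by (rule finite_representation)
qed

lemma rep_C_ext: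
  assumes l: "l \<in> index_set D" "S \<in> mat_index D l" "T \<in> mat_index D l"
    and x: "x \<in> ext_carrier (table_basis D l)" and z: "z \<in> triples D"
  shows "rep (C_ext scale C l S x T) (C z) =
    (if fst z = l \<and> fst (snd z) = S \<and> snd (snd (snd z)) = T
     then Poly_Mapping.lookup x (fst (snd (snd z))) else 0)"
proof -
  obtain l' S' b' T' where zz: "z = (l', S', b', T')" by (cases z)
  have "rep (C_ext scale C l S x T) (C z) =
    (\<Sum>b\<in>Poly_Mapping.keys x. Poly_Mapping.lookup x b * (if z = (l, S, b, T) then 1 else 0))"
    unfolding C_ext_def rep_sum rep_scale
  proof (intro sum.cong refl)
    fix b assume "b \<in> Poly_Mapping.keys x"
    then have t: "(l, S, b, T) \<in> triples D" using l x by (auto simp: ext_carrier_def)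
    show "Poly_Mapping.lookup x b * rep (C (l, S, b, T)) (C z) =
      Poly_Mapping.lookup x b * (if z = (l, S, b, T) then 1 else 0)"
      using rep_basis[OF C_in[OF t]] C_eq[OF z t] by simp
  qed
  also have "\<dots> = (if l' = l \<and> S' = S \<and> T' = T then Poly_Mapping.lookup x b' else 0)"
  proof (cases "l' = l \<and> S' = S \<and> T' = T")
    case True
    then have "(\<Sum>b\<in>Poly_Mapping.keys x. Poly_Mapping.lookup x b * (if z = (l, S, b, T) then 1 else 0)) =
      (\<Sum>b\<in>Poly_Mapping.keys x. if b' = b then Poly_Mapping.lookup x b else 0)"
      by (intro sum.cong) (auto simp: zz)
    also have "\<dots> = Poly_Mapping.lookup x b'"
      by (simp add: in_keys_iff)
    finally show ?thesis using True by simp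
  next
    case False
    then show ?thesis by (auto simp: zz)
  qed
  finally show ?thesis by (simp add: zz)
qed

text \<open>The spanning set of A(<l) is part of the tabular basis, so membership can be tested on
  coordinates; injectivity of \<open>C\<close> then translates basis elements back into
  triples.\<close>

lemma A_below_iff:
  "x \<in> A_below scale D C l \<longleftrightarrow>
    (\<forall>z\<in>triples D. rep x (C z) \<noteq> 0 \<longrightarrow> (fst z, l) \<in> index_le D \<and> fst z \<noteq> l)"
proof -
  let ?S = "\<Union>k\<in>{k \<in> index_set D. (k, l) \<in> index_le D \<and> k \<noteq> l}. C ` cell_dom D k"
  have S: "?S = C ` {z \<in> triples D. (fst z, l) \<in> index_le D \<and> fst z \<noteq> l}"
    by (auto simp: cell_dom_def image_iff) force+
  have "?S \<subseteq> BB" unfolding S using image by auto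
  from in_span_iff[OF this] have "x \<in> A_below scale D C l \<longleftrightarrow> (\<forall>Z. rep x Z \<noteq> 0 \<longrightarrow> Z \<in> ?S)"
    unfolding A_below_def .
  also have "\<dots> \<longleftrightarrow> (\<forall>z\<in>triples D. rep x (C z) \<noteq> 0 \<longrightarrow> (fst z, l) \<in> index_le D \<and> fst z \<noteq> l)"
  proof
    assume *: "\<forall>Z. rep x Z \<noteq> 0 \<longrightarrow> Z \<in> ?S"
    show "\<forall>z\<in>triples D. rep x (C z) \<noteq> 0 \<longrightarrow> (fst z, l) \<in> index_le D \<and> fst z \<noteq> l"
    proof (intro ballI impI)
      fix z assume z: "z \<in> triples D" "rep x (C z) \<noteq> 0"
      then obtain y where "y \<in> triples D" "(fst y, l) \<in> index_le D" "fst y \<noteq> l" "C z = C y"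
        using * unfolding S by blast
      then show "(fst z, l) \<in> index_le D \<and> fst z \<noteq> l" using C_eq z by auto
    qed
  next
    assume *: "\<forall>z\<in>triples D. rep x (C z) \<noteq> 0 \<longrightarrow> (fst z, l) \<in> index_le D \<and> fst z \<noteq> l"
    show "\<forall>Z. rep x Z \<noteq> 0 \<longrightarrow> Z \<in> ?S"
    proof (intro allI impI)
      fix Z assume Z: "rep x Z \<noteq> 0"
      then obtain z where "z \<in> triples D" "Z = C z" using representation_ne_zero image by blast
      then show "Z \<in> ?S" using * Z unfolding S by blast
    qed
  qed
  finally show ?thesis .
qed

lemma single_carrier: "b \<in> table_basis D l \<Longrightarrow> Poly_Mapping.single b 1 \<in> ext_carrier (table_basis D l)"
  by (simp add: ext_carrier_def)

lemma cell_action_iff: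
  "cell_action scale D C \<longleftrightarrow>
    (\<forall>a. \<forall>t\<in>triples D. \<forall>z\<in>triples D.
       (rep (a * C t) (C z) \<noteq> 0 \<longrightarrow> (fst z, fst t) \<in> index_le D) \<and>
       (fst z = fst t \<longrightarrow>
          rep (a * C t) (C z) =
            (\<Sum>y\<in>{y \<in> triples D. rep (a * C (left_unit D t)) (C y) \<noteq> 0}.
               rep (a * C (left_unit D t)) (C y) * of_int (asymp_coeff D y t z))))"
  unfolding cell_action_def image Let_def ..

lemma rep_sum_C_ext:
  assumes l: "l \<in> index_set D" "T \<in> mat_index D l"
    and x: "\<And>S. S \<in> mat_index D l \<Longrightarrow> x S \<in> ext_carrier (table_basis D l)"
    and z: "(l', S', b, T') \<in> triples D"
  shows "rep (\<Sum>S\<in>mat_index D l. C_ext scale C l S (x S) T) (C (l', S', b, T')) =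
    (if l' = l \<and> T' = T then Poly_Mapping.lookup (x S') b else 0)"
proof -
  have "rep (\<Sum>S\<in>mat_index D l. C_ext scale C l S (x S) T) (C (l', S', b, T')) =
    (\<Sum>S\<in>mat_index D l. if S' = S then if l' = l \<and> T' = T then Poly_Mapping.lookup (x S) b else 0 else 0)"
    unfolding rep_sum by (intro sum.cong refl, subst rep_C_ext[OF l(1) _ l(2) x z]) auto
  also have "\<dots> = (if l' = l \<and> T' = T then Poly_Mapping.lookup (x S') b else 0)"
    using z finite_mat[OF l(1)] by (subst sum.delta') auto
  finally show ?thesis .
qed

text \<open>Elements of A(<l) have no coordinates in cell \<open>l\<close>, so there the congruence
  of (A3) is an equality. Taking \<open>g\<close> to be the unit identifies \<open>r\<close> with
  coordinates of \<open>a * C (left_unit D t)\<close>; substituting them back gives the formula.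
  Outside the cell only A(<l) contributes, which yields the order relation.\<close>

lemma cell_action_if_axiom_A3:
  assumes A3: "axiom_A3 scale D C"
  shows "cell_action scale D C"
  unfolding cell_action_iff
proof (intro allI ballI)
  fix a t z assume t: "t \<in> triples D" and z: "z \<in> triples D"
  obtain l S b T where tt: "t = (l, S, b, T)" by (cases t)
  obtain l' S' b' T' where zz: "z = (l', S', b', T')" by (cases z)
  let ?R = "table_alg D l" and ?B = "table_basis D l" and ?M = "mat_index D l"
  have l: "l \<in> index_set D" "S \<in> ?M" "b \<in> ?B" "T \<in> ?M" using t by (auto simp: tt)
  note F = table_familyD[OF family l(1)]
  obtain r where r0: "\<forall>S'\<in>?M. \<forall>S\<in>?M. r S' S \<in> ext_carrier ?B"
    and A3': "\<forall>S\<in>?M. \<forall>T\<in>?M. \<forall>g\<in>carrier ?R.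
        a * C_ext scale C l S (ext_embed ?R ?B g) T
             - (\<Sum>S'\<in>?M. C_ext scale C l S' (ext_mult ?R ?B (r S' S) (ext_embed ?R ?B g)) T)
           \<in> A_below scale D C l"
    using spec[OF bspec[OF A3[unfolded axiom_A3_def Let_def] l(1)], of a]
    by (elim exE conjE) (rule that)
  have r: "r S' S \<in> ext_carrier ?B" if "S' \<in> ?M" "S \<in> ?M" for S' S
    using r0 that by blast
  \<comment> \<open>The coefficient of row \<open>S'\<close> in (A3) for the basis element \<beta>,
    namely the product of \<open>r S' S\<close> with \<beta>.\<close>
  define e where "e \<beta> S' = ext_mult ?R ?B (r S' S) (Poly_Mapping.single \<beta> 1)" for \<beta> S'
  have e: "e \<beta> X \<in> ext_carrier ?B" if "\<beta> \<in> ?B" "X \<in> ?M" for \<beta> X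
    unfolding e_def using that r l F by (intro ext_mult_carrier single_carrier) auto
  have le: "Poly_Mapping.lookup (e \<beta> X) c =
      (\<Sum>b1\<in>Poly_Mapping.keys (r X S). Poly_Mapping.lookup (r X S) b1 * of_int (kappa ?R ?B c (b1 \<otimes>\<^bsub>?R\<^esub> \<beta>)))"
    for \<beta> X c
    unfolding e_def lookup_ext_mult by simp
  have below: "a * C (l, S, \<beta>, U) - (\<Sum>S'\<in>?M. C_ext scale C l S' (e \<beta> S') U) \<in> A_below scale D C l"
    if "\<beta> \<in> ?B" "U \<in> ?M" for \<beta> U
  proof -
    have "\<beta> \<in> carrier ?R" using table_basis_carrier[OF F(1)] that by auto
    from A3'[THEN bspec, OF l(2), THEN bspec, OF that(2), THEN bspec, OF this] show ?thesis
      by (simp add: ext_embed_basis[OF F(1) that(1)] e_def C_ext_def)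
  qed
  have act: "rep (a * C (l, S, \<beta>, U)) (C (l, X, c, Y)) =
      (if Y = U then Poly_Mapping.lookup (e \<beta> X) c else 0)"
    if "\<beta> \<in> ?B" "U \<in> ?M" "X \<in> ?M" "c \<in> ?B" "Y \<in> ?M" for \<beta> U X c Y
  proof -
    have y: "(l, X, c, Y) \<in> triples D" using that l by simp
    have "rep (a * C (l, S, \<beta>, U) - (\<Sum>S'\<in>?M. C_ext scale C l S' (e \<beta> S') U)) (C (l, X, c, Y)) = 0"
      using below[OF that(1,2)] y unfolding A_below_iff by force
    moreover have "rep (\<Sum>S'\<in>?M. C_ext scale C l S' (e \<beta> S') U) (C (l, X, c, Y)) =
        (if l = l \<and> Y = U then Poly_Mapping.lookup (e \<beta> X) c else 0)"
      by (rule rep_sum_C_ext[OF l(1) that(2) e[OF that(1)] y])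
    ultimately show ?thesis unfolding rep_diff by simp
  qed
  show "(rep (a * C t) (C z) \<noteq> 0 \<longrightarrow> (fst z, fst t) \<in> index_le D) \<and>
       (fst z = fst t \<longrightarrow>
          rep (a * C t) (C z) =
            (\<Sum>y\<in>{y \<in> triples D. rep (a * C (left_unit D t)) (C y) \<noteq> 0}.
               rep (a * C (left_unit D t)) (C y) * of_int (asymp_coeff D y t z)))"
  proof (intro conjI impI)
    assume nz: "rep (a * C t) (C z) \<noteq> 0"
    show "(fst z, fst t) \<in> index_le D"
    proof (cases "l' = l")
      case True
      then show ?thesis using order l unfolding partial_order_on_def preorder_on_def refl_on_def
        by (simp add: tt zz)
    next
      case False
      then have "rep (a * C (l, S, b, T) - (\<Sum>S'\<in>?M. C_ext scale C l S' (e b S') T)) (C z) \<noteq> 0"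
        using nz rep_sum_C_ext[where x = "e b", OF l(1,4) e[OF l(3)] z[unfolded zz]]
        unfolding rep_diff by (simp add: tt zz)
      then show ?thesis using below[OF l(3,4)] z unfolding A_below_iff by (auto simp: tt zz)
    qed
  next
    assume "fst z = fst t"
    then have zz': "z = (l, S', b', T')" by (simp add: tt zz)
    then have z': "S' \<in> ?M" "b' \<in> ?B" "T' \<in> ?M" using z by auto
    let ?f = "\<lambda>y. rep (a * C (left_unit D t)) (C y)"
    \<comment> \<open>With entry 1 the product defining \<open>e\<close> is \<open>r S' S\<close>
      itself.\<close>
    have f: "?f (l, S', c, S) = Poly_Mapping.lookup (r S' S) c" if "c \<in> ?B" for c
    proof -
      have "?f (l, S', c, S) = Poly_Mapping.lookup (e \<one>\<^bsub>?R\<^esub> S') c"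
        using act[OF F(2) l(2) z'(1) that l(2)] by (simp add: tt)
      also have "\<dots> = (\<Sum>b1\<in>Poly_Mapping.keys (r S' S). if c = b1 then Poly_Mapping.lookup (r S' S) b1 else 0)"
        unfolding le using kappa_mult_one(1)[OF F(1)] r[OF z'(1) l(2)]
        by (intro sum.cong refl) (auto simp: ext_carrier_def)
      also have "\<dots> = Poly_Mapping.lookup (r S' S) c" by (simp add: in_keys_iff)
      finally show ?thesis .
    qed
    have "{c \<in> ?B. ?f (l, S', c, S) \<noteq> 0} = Poly_Mapping.keys (r S' S)"
      using f r[OF z'(1) l(2)] by (auto simp: ext_carrier_def in_keys_iff)
    then have "(\<Sum>c\<in>{c \<in> ?B. ?f (l, S', c, S) \<noteq> 0}. ?f (l, S', c, S) * of_int (kappa ?R ?B b' (c \<otimes>\<^bsub>?R\<^esub> b)))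
        = Poly_Mapping.lookup (e b S') b'"
      unfolding le using f r[OF z'(1) l(2)] by (intro sum.cong) (auto simp: ext_carrier_def)
    then have "(\<Sum>y\<in>{y \<in> triples D. ?f y \<noteq> 0}. ?f y * of_int (asymp_coeff D y t z)) =
       (if T' = T then Poly_Mapping.lookup (e b S') b' else 0)"
      unfolding zz' tt
      using asymp_sum[where f = ?f, OF finite_support l(1,2) z'(1), of b T b' T'] by (simp add: tt)
    then show "rep (a * C t) (C z) = (\<Sum>y\<in>{y \<in> triples D. ?f y \<noteq> 0}. ?f y * of_int (asymp_coeff D y t z))"
      using act[OF l(3,4) z'] by (simp add: tt zz')
  qed
qed

text \<open>The coefficients of (A3) are defined as the coordinates of \<open>a\<close> times a
  diagonal basis element. The formula for basis elements extends linearly to all \<open>g\<close>,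
  so the difference has no coordinates in cell \<open>l\<close>; those elsewhere lie below by the
  order clause.\<close>

lemma axiom_A3_if_cell_action:
  assumes act: "cell_action scale D C"
  shows "axiom_A3 scale D C"
  unfolding axiom_A3_def Let_def
proof (intro ballI allI)
  fix l a assume l: "l \<in> index_set D"
  let ?R = "table_alg D l" and ?B = "table_basis D l" and ?M = "mat_index D l"
  note F = table_familyD[OF family l]
  define u where "u S = C (l, S, \<one>\<^bsub>?R\<^esub>, S)" for S
  \<comment> \<open>The cutoff at \<open>?B\<close> matters: outside the triples \<open>C\<close> is
    arbitrary and may hit a basis element, which would put spurious entries into the
    support.\<close>
  define r where "r S' S = Abs_poly_mapping (\<lambda>c. if c \<in> ?B then rep (a * u S) (C (l, S', c, S)) else 0)" for S' S
  have fin: "finite {c \<in> ?B. rep x (C (l, S', c, S)) \<noteq> 0}" if "S' \<in> ?M" "S \<in> ?M" for S' S x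
  proof (rule inj_on_finite[OF _ _ finite_support[of x]])
    show "inj_on (\<lambda>c. (l, S', c, S)) {c \<in> ?B. rep x (C (l, S', c, S)) \<noteq> 0}" by (auto simp: inj_on_def)
  qed (use that l in auto)
  have lr: "Poly_Mapping.lookup (r S' S) c = (if c \<in> ?B then rep (a * u S) (C (l, S', c, S)) else 0)"
    if "S' \<in> ?M" "S \<in> ?M" for S' S c
    unfolding r_def using fin[OF that, of "a * u S"]
    by (subst lookup_Abs_poly_mapping) (auto elim: rev_finite_subset)
  have keys: "Poly_Mapping.keys (r S' S) = {c \<in> ?B. rep (a * u S) (C (l, S', c, S)) \<noteq> 0}"
    if "S' \<in> ?M" "S \<in> ?M" for S' S
    using lr[OF that] by (auto simp: in_keys_iff split: if_splits)
  have rc: "r S' S \<in> ext_carrier ?B" if "S' \<in> ?M" "S \<in> ?M" for S' S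
    using keys[OF that] by (auto simp: ext_carrier_def)
  have cell: "rep (a * C (l, S, b, T)) (C (l, S', b', T')) =
      (if T' = T then \<Sum>c\<in>Poly_Mapping.keys (r S' S). Poly_Mapping.lookup (r S' S) c *
         of_int (kappa ?R ?B b' (c \<otimes>\<^bsub>?R\<^esub> b)) else 0)"
    if "S \<in> ?M" "b \<in> ?B" "T \<in> ?M" "S' \<in> ?M" "b' \<in> ?B" "T' \<in> ?M" for S b T S' b' T'
  proof -
    let ?t = "(l, S, b, T)" and ?z = "(l, S', b', T')"
    let ?f = "\<lambda>y. rep (a * u S) (C y)"
    have "rep (a * C ?t) (C ?z) = (\<Sum>y\<in>{y \<in> triples D. ?f y \<noteq> 0}. ?f y * of_int (asymp_coeff D y ?t ?z))"
      using act[unfolded cell_action_iff, rule_format, of ?t ?z a] that l by (simp add: u_def)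
    also have "\<dots> = (if T' = T then \<Sum>c\<in>{c \<in> ?B. ?f (l, S', c, S) \<noteq> 0}. ?f (l, S', c, S) *
         of_int (kappa ?R ?B b' (c \<otimes>\<^bsub>?R\<^esub> b)) else 0)"
      by (rule asymp_sum[OF finite_support l that(1,4)])
    also have "(\<Sum>c\<in>{c \<in> ?B. ?f (l, S', c, S) \<noteq> 0}. ?f (l, S', c, S) *
         of_int (kappa ?R ?B b' (c \<otimes>\<^bsub>?R\<^esub> b))) = (\<Sum>c\<in>Poly_Mapping.keys (r S' S). Poly_Mapping.lookup (r S' S) c *
         of_int (kappa ?R ?B b' (c \<otimes>\<^bsub>?R\<^esub> b)))"
      unfolding keys[OF that(4,1)] by (intro sum.cong refl) (simp add: lr[OF that(4,1)])
    finally show ?thesis .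
  qed
  have "a * C_ext scale C l S (ext_embed ?R ?B g) T
          - (\<Sum>S'\<in>?M. C_ext scale C l S' (ext_mult ?R ?B (r S' S) (ext_embed ?R ?B g)) T) \<in> A_below scale D C l"
    if S: "S \<in> ?M" and T: "T \<in> ?M" and g: "g \<in> carrier ?R" for S T g
    unfolding A_below_iff
  proof (intro ballI impI)
    let ?x = "ext_embed ?R ?B g"
    fix z assume z: "z \<in> triples D" and nz: "rep (a * C_ext scale C l S ?x T
          - (\<Sum>S'\<in>?M. C_ext scale C l S' (ext_mult ?R ?B (r S' S) ?x) T)) (C z) \<noteq> 0"
    obtain l' S' b' T' where zz: "z = (l', S', b', T')" by (cases z)
    have x: "?x \<in> ext_carrier ?B" by (rule ext_embed_carrier[OF F(1) g])
    have left: "rep (a * C_ext scale C l S ?x T) (C z) =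
      (\<Sum>b\<in>Poly_Mapping.keys ?x. Poly_Mapping.lookup ?x b * rep (a * C (l, S, b, T)) (C z))"
      unfolding C_ext_def sum_distrib_left mult_scale rep_sum rep_scale ..
    have right: "rep (\<Sum>S'\<in>?M. C_ext scale C l S' (ext_mult ?R ?B (r S' S) ?x) T) (C z) =
      (if l' = l \<and> T' = T then Poly_Mapping.lookup (ext_mult ?R ?B (r S' S) ?x) b' else 0)"
      unfolding zz using z S by (intro rep_sum_C_ext l T ext_mult_carrier F(1) rc x) (auto simp: zz)
    \<comment> \<open>Within cell \<open>l\<close> both parts of the difference expand to the same
      double sum over the supports of \<open>r S' S\<close> and \<open>?x\<close>.\<close>
    have "l' \<noteq> l"
    proof
      assume eq: "l' = l"
      then have z': "S' \<in> ?M" "b' \<in> ?B" "T' \<in> ?M" using z by (auto simp: zz)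
      have xb: "b \<in> ?B" if "b \<in> Poly_Mapping.keys ?x" for b using x that by (auto simp: ext_carrier_def)
      have "rep (a * C_ext scale C l S ?x T) (C z) =
        (\<Sum>b\<in>Poly_Mapping.keys ?x. Poly_Mapping.lookup ?x b * (if T' = T then \<Sum>c\<in>Poly_Mapping.keys (r S' S).
           Poly_Mapping.lookup (r S' S) c * of_int (kappa ?R ?B b' (c \<otimes>\<^bsub>?R\<^esub> b)) else 0))"
        unfolding zz eq left[unfolded zz eq]
        by (intro sum.cong refl arg_cong2[where f = "(*)"] cell) (use xb S T z' in auto)
      also have "\<dots> = (if T' = T then Poly_Mapping.lookup (ext_mult ?R ?B (r S' S) ?x) b' else 0)"
        unfolding lookup_ext_mult
        by (simp add: sum_distrib_left sum.swap[of _ "Poly_Mapping.keys (r S' S)"] ac_simps)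
      finally show False using nz right eq unfolding rep_diff by simp
    qed
    moreover have "(fst z, l) \<in> index_le D"
    proof -
      \<comment> \<open>Away from cell \<open>l\<close> the subtracted sum has coordinate 0, so some
        basis element in the expansion of \<open>?x\<close> already produces
        \<open>z\<close>.\<close>
      have "rep (a * C_ext scale C l S ?x T) (C z) \<noteq> 0"
        using nz right \<open>l' \<noteq> l\<close> unfolding rep_diff by simp
      then obtain b where b: "b \<in> Poly_Mapping.keys ?x" "rep (a * C (l, S, b, T)) (C z) \<noteq> 0"
        unfolding left by (metis (no_types, lifting) mult_zero_right sum.neutral)
      then have "(l, S, b, T) \<in> triples D" using x l S T by (auto simp: ext_carrier_def)
      then show ?thesis using act[unfolded cell_action_iff] z b(2) by fastforce
    qed
    ultimately show "(fst z, l) \<in> index_le D \<and> fst z \<noteq> l" by (simp add: zz)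
  qed
  then show "\<exists>r. (\<forall>S'\<in>?M. \<forall>S\<in>?M. r S' S \<in> ext_carrier ?B) \<and>
      (\<forall>S\<in>?M. \<forall>T\<in>?M. \<forall>g\<in>carrier ?R. a * C_ext scale C l S (ext_embed ?R ?B g) T
          - (\<Sum>S'\<in>?M. C_ext scale C l S' (ext_mult ?R ?B (r S' S) (ext_embed ?R ?B g)) T) \<in> A_below scale D C l)"
    using rc by (intro exI[of _ r]) blast
qed

end

section \<open>Leading coefficients\<close>

lemma lookup_mult_of_int:
  "Poly_Mapping.lookup ((p::laurent) * of_int k) n = Poly_Mapping.lookup p n * k"
proof (induction k rule: int_induct[where k = 0])
  case (step1 i)
  then show ?case by (simp add: distrib_left lookup_add algebra_simps)
next
  case (step2 i)
  then show ?case by (simp add: right_diff_distrib lookup_minus)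
qed simp

section \<open>Linear maps that permute the basis\<close>

context based_algebra
begin

text \<open>Apply \<open>f\<close> to the expansion of \<open>x\<close>; injectivity keeps distinct
  basis elements apart. Multiplicativity does not enter, so this serves for the star as well as for
  automorphisms.\<close>

lemma rep_hom:
  assumes f: "module_hom scale scale f" "inj f" "f ` BB \<subseteq> BB" and Z: "Z \<in> BB"
  shows "rep (f x) (f Z) = rep x Z"
proof -
  interpret f: module_hom scale scale f by (rule f(1))
  let ?S = "{Y. rep x Y \<noteq> 0}"
  have fin: "finite ?S" by (rule finite_representation)
  have "f x = f (\<Sum>Y\<in>?S. scale (rep x Y) Y)"
    using sum_nonzero_representation_eq[OF indep] spans by simp
  also have "\<dots> = (\<Sum>Y\<in>?S. scale (rep x Y) (f Y))" by (simp add: f.sum f.scale)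
  finally have "rep (f x) (f Z) = (\<Sum>Y\<in>?S. rep x Y * rep (f Y) (f Z))"
    by (simp add: rep_sum rep_scale)
  also have "\<dots> = (\<Sum>Y\<in>?S. if Z = Y then rep x Y else 0)"
  proof (intro sum.cong refl)
    fix Y assume "Y \<in> ?S"
    then have "f Y \<in> BB" using representation_ne_zero f(3) by blast
    then show "rep x Y * rep (f Y) (f Z) = (if Z = Y then rep x Y else 0)"
      using rep_basis[of "f Y" "f Z"] inj_eq[OF f(2)] by auto
  qed
  also have "\<dots> = rep x Z" using fin by simp
  finally show ?thesis .
qed

text \<open>The pairs of basis elements whose products are examined are merely permuted, with the
  factors swapped in the anti-multiplicative case, so the two sets of degrees coincide.\<close>

lemma a_fun_hom:
  assumes f: "module_hom scale scale f" "inj f" "f ` BB = BB" and Z: "Z \<in> BB"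
    and mult: "(\<forall>x y. f (x * y) = f x * f y) \<or> (\<forall>x y. f (x * y) = f y * f x)"
  shows "a_fun scale BB (f Z) = a_fun scale BB Z"
proof -
  have r: "rep (f x) (f Z) = rep x Z" for x using rep_hom f Z by simp
  have "strc_degrees scale BB (f Z) = strc_degrees scale BB Z"
  proof (intro equalityI subsetI)
    fix n assume "n \<in> strc_degrees scale BB (f Z)"
    then obtain X Y where XY: "X \<in> BB" "Y \<in> BB" "n = ldeg (rep (X * Y) (f Z))" "rep (X * Y) (f Z) \<noteq> 0"
      unfolding strc_degrees_def strc_def by auto
    obtain X' Y' where XY': "X' \<in> BB" "Y' \<in> BB" "X = f X'" "Y = f Y'" using XY(1,2) f(3) by (metis imageE)
    from mult consider "X * Y = f (X' * Y')" | "X * Y = f (Y' * X')" using XY' by metis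
    then show "n \<in> strc_degrees scale BB Z"
      unfolding strc_degrees_def strc_def using XY XY' r by cases auto
  next
    fix n assume "n \<in> strc_degrees scale BB Z"
    then obtain X Y where XY: "X \<in> BB" "Y \<in> BB" "n = ldeg (rep (X * Y) Z)" "rep (X * Y) Z \<noteq> 0"
      unfolding strc_degrees_def strc_def by auto
    have fX: "f X \<in> BB" "f Y \<in> BB" using XY f(3) by auto
    from mult consider "f (X * Y) = f X * f Y" | "f (X * Y) = f Y * f X" by metis
    then show "n \<in> strc_degrees scale BB (f Z)"
      unfolding strc_degrees_def strc_def using XY fX r[of "X * Y"] by cases force+
  qed
  then show ?thesis unfolding a_fun_def by simp
qed

end

section \<open>Degrees and leading coefficients in a tabular algebra with the a-function\<close>

locale tabular = table_setting scale BB D C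
  for scale :: "laurent \<Rightarrow> 'a::ring \<Rightarrow> 'a" and BB
    and D :: "('l, 'g, 'm, 'a) table_object" and C :: "'l \<times> 'm \<times> 'g \<times> 'm \<Rightarrow> 'a" +
  assumes A2: "axiom_A2 scale D C" and act: "cell_action scale D C"
    and ae: "a_exists scale BB" and A4: "axiom_A4 scale D C"
begin

abbreviation a :: "'l \<times> 'm \<times> 'g \<times> 'm \<Rightarrow> int" where "a t \<equiv> a_fun scale BB (C t)"

abbreviation g where "g t y z \<equiv> rep (C t * C y) (C z)"

abbreviation \<gamma> where "\<gamma> t y z \<equiv> gamma scale BB (C t) (C y) (C z)"

lemma \<gamma>_eq: "\<gamma> t y z = Poly_Mapping.lookup (g t y z) (a z)"
  by (simp add: gamma_def strc_def)

text \<open>The assumption \<open>ae\<close> guarantees that the \<open>GREATEST\<close> in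
  \<open>a_fun\<close> is an attained maximum.\<close>

lemma degree_le_a:
  assumes "t \<in> triples D" "y \<in> triples D" "z \<in> triples D"
    and n: "Poly_Mapping.lookup (g t y z) n \<noteq> 0"
  shows "n \<le> a z"
proof -
  obtain m where m: "m \<in> strc_degrees scale BB (C z)" "\<And>k. k \<in> strc_degrees scale BB (C z) \<Longrightarrow> k \<le> m"
    using ae C_in[OF assms(3)] unfolding a_exists_def by blast
  then have "a z = m" unfolding a_fun_def by (intro Greatest_equality)
  moreover have "ldeg (g t y z) \<in> strc_degrees scale BB (C z)"
    unfolding strc_degrees_def strc_def mem_Collect_eq
    by (rule exI[of _ "C t"], rule exI[of _ "C y"]) (use n C_in assms in auto)
  moreover have "n \<le> ldeg (g t y z)"
    unfolding ldeg_def using n by (intro Max_ge) (auto simp: in_keys_iff)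
  ultimately show ?thesis using m(2) by fastforce
qed

lemma top_degree_iff:
  assumes t: "t \<in> triples D" and y: "y \<in> triples D" and z: "z \<in> triples D"
  shows "g t y z \<noteq> 0 \<and> ldeg (g t y z) = a z \<longleftrightarrow> asymp_coeff D t y z \<noteq> 0"
proof -
  obtain l S b T where tt: "t = (l, S, b, T)" by (cases t)
  obtain l' U b' V where yy: "y = (l', U, b', V)" by (cases y)
  obtain l'' X b'' Y where zz: "z = (l'', X, b'', Y)" by (cases z)
  show ?thesis
    using A4[unfolded axiom_A4_def Let_def image strc_def, THEN bspec, OF t[unfolded tt],
        unfolded prod.case, THEN bspec, OF y[unfolded yy], unfolded prod.case,
        THEN bspec, OF z[unfolded zz], unfolded prod.case, THEN conjunct1]
    unfolding tt yy zz by (auto split: if_splits)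
qed

text \<open>Since no exponent exceeds \<open>a z\<close>, a nonzero coefficient there means that the
  degree equals \<open>a z\<close>, and this is the condition in (A4). It remains to compare the
  nonzero values.\<close>

lemma \<gamma>_nonzero_iff:
  assumes t: "t \<in> triples D" and y: "y \<in> triples D" and z: "z \<in> triples D"
  shows "\<gamma> t y z \<noteq> 0 \<longleftrightarrow> asymp_coeff D t y z \<noteq> 0"
proof -
  have "\<gamma> t y z \<noteq> 0 \<longleftrightarrow> g t y z \<noteq> 0 \<and> ldeg (g t y z) = a z"
  proof
    assume nz: "\<gamma> t y z \<noteq> 0"
    have "ldeg (g t y z) = a z"
      unfolding ldeg_def
      by (intro Max_eqI) (use nz degree_le_a[OF t y z] in \<open>auto simp: in_keys_iff \<gamma>_eq\<close>)
    then show "g t y z \<noteq> 0 \<and> ldeg (g t y z) = a z" using nz \<gamma>_eq by auto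
  next
    assume *: "g t y z \<noteq> 0 \<and> ldeg (g t y z) = a z"
    then have "Max (Poly_Mapping.keys (g t y z)) \<in> Poly_Mapping.keys (g t y z)"
      by (intro Max_in) auto
    then show "\<gamma> t y z \<noteq> 0" using * unfolding \<gamma>_eq ldeg_def by (simp add: in_keys_iff)
  qed
  then show ?thesis using top_degree_iff[OF t y z] by simp
qed

lemma \<gamma>_one:
  assumes "l \<in> index_set D" "S \<in> mat_index D l"
  shows "\<gamma> (l, S, \<one>\<^bsub>table_alg D l\<^esub>, S) (l, S, \<one>\<^bsub>table_alg D l\<^esub>, S) (l, S, \<one>\<^bsub>table_alg D l\<^esub>, S) = 1"
proof -
  note F = table_familyD[OF family assms(1)]
  let ?o = "\<one>\<^bsub>table_alg D l\<^esub>"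
  have t: "(l, S, ?o, S) \<in> triples D" using assms F by simp
  have "kappa (table_alg D l) (table_basis D l) ?o (?o \<otimes>\<^bsub>table_alg D l\<^esub> ?o) \<noteq> 0"
    by (simp add: kappa_mult_one(1)[OF F(1,2)])
  then show ?thesis
    using A4[unfolded axiom_A4_def Let_def image, THEN bspec, OF t, unfolded prod.case,
        THEN bspec, OF t, unfolded prod.case, THEN bspec, OF t, unfolded prod.case] by blast
qed

lemma star_C: "t \<in> triples D \<Longrightarrow> star D (C t) = C (flip D t)"
  using A2 unfolding axiom_A2_def by (cases t) simp

lemma star_facts:
  shows star_hom: "module_hom scale scale (star D)" and inj_star: "inj (star D)"
    and star_image: "star D ` BB = BB" and star_mult: "star D (x * y) = star D y * star D x"
proof -
  have s: "involutory_antiautomorphism scale (star D)" using A2 unfolding axiom_A2_def by blast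
  then show "module_hom scale scale (star D)" "star D (x * y) = star D y * star D x"
    unfolding involutory_antiautomorphism_def by blast+
  have ss: "star D (star D x) = x" for x using s unfolding involutory_antiautomorphism_def by blast
  then show "inj (star D)" by (rule inj_on_inverseI)
  have sub: "star D X \<in> BB" if "X \<in> BB" for X
    using that star_C flip_in[OF family] C_in image by (metis imageE)
  show "star D ` BB = BB"
  proof (intro equalityI subsetI)
    fix X assume "X \<in> BB"
    then show "X \<in> star D ` BB" using sub ss by (metis imageI)
  qed (use sub in auto)
qed

lemma a_flip: "t \<in> triples D \<Longrightarrow> a (flip D t) = a t"
  using a_fun_hom[OF star_hom inj_star star_image C_in] star_mult star_C by metis

text \<open>The star permutes the basis, reverses products and preserves the a-function.\<close>

lemma \<gamma>_flip:
  assumes "t \<in> triples D" "y \<in> triples D" "z \<in> triples D"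
  shows "\<gamma> (flip D y) (flip D t) (flip D z) = \<gamma> t y z"
proof -
  have "g (flip D y) (flip D t) (flip D z) = rep (star D (C t * C y)) (star D (C z))"
    using assms by (simp add: star_mult star_C)
  also have "\<dots> = g t y z" using rep_hom[OF star_hom inj_star] star_image C_in assms by simp
  finally show ?thesis unfolding \<gamma>_eq a_flip[OF assms(3)] by simp
qed

text \<open>The second clause of \<open>cell_action\<close> within one cell, collapsed by
  \<open>asymp_sum\<close> to a finite sum over the table basis.\<close>

lemma cell_formula:
  fixes x :: 'a
  assumes l: "l \<in> index_set D" "S \<in> mat_index D l" "T \<in> mat_index D l" "b \<in> table_basis D l"
      "S' \<in> mat_index D l" "T' \<in> mat_index D l" "b' \<in> table_basis D l"
  defines "f \<equiv> \<lambda>c. rep (x * C (l, S, \<one>\<^bsub>table_alg D l\<^esub>, S)) (C (l, S', c, S))"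
  shows "rep (x * C (l, S, b, T)) (C (l, S', b', T')) =
    (if T' = T then \<Sum>c\<in>{c \<in> table_basis D l. f c \<noteq> 0}.
       f c * of_int (kappa (table_alg D l) (table_basis D l) b' (c \<otimes>\<^bsub>table_alg D l\<^esub> b)) else 0)"
    and "finite {c \<in> table_basis D l. f c \<noteq> 0}"
proof -
  let ?t = "(l, S, b, T)" and ?z = "(l, S', b', T')"
  let ?f = "\<lambda>y. rep (x * C (left_unit D ?t)) (C y)"
  have "rep (x * C ?t) (C ?z) = (\<Sum>y\<in>{y \<in> triples D. ?f y \<noteq> 0}. ?f y * of_int (asymp_coeff D y ?t ?z))"
    using act[unfolded cell_action_iff, rule_format, of ?t ?z x] l by simp
  also have "\<dots> = (if T' = T then \<Sum>c\<in>{c \<in> table_basis D l. f c \<noteq> 0}.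
       f c * of_int (kappa (table_alg D l) (table_basis D l) b' (c \<otimes>\<^bsub>table_alg D l\<^esub> b)) else 0)"
    using asymp_sum[where f = ?f, OF finite_support l(1,2,5)] by (simp add: f_def)
  finally show "rep (x * C ?t) (C ?z) = (if T' = T then \<Sum>c\<in>{c \<in> table_basis D l. f c \<noteq> 0}.
       f c * of_int (kappa (table_alg D l) (table_basis D l) b' (c \<otimes>\<^bsub>table_alg D l\<^esub> b)) else 0)" .
  show "finite {c \<in> table_basis D l. f c \<noteq> 0}"
  proof (rule inj_on_finite[OF _ _ finite_support[of "x * C (l, S, \<one>\<^bsub>table_alg D l\<^esub>, S)"]])
    show "inj_on (\<lambda>c. (l, S', c, S)) {c \<in> table_basis D l. f c \<noteq> 0}" by (auto simp: inj_on_def)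
  qed (use l in \<open>auto simp: f_def\<close>)
qed

section \<open>Constancy of the a-function and the leading coefficients within one cell\<close>

context
  fixes l assumes l: "l \<in> index_set D"
begin

abbreviation "R \<equiv> table_alg D l"
abbreviation "B \<equiv> table_basis D l"
abbreviation "M \<equiv> mat_index D l"

lemmas F = table_familyD[OF family l]

text \<open>The independence of \<open>r\<^sub>a\<close> from the second index \<open>T\<close> in (A3).\<close>

lemma column_change:
  assumes "S \<in> M" "S' \<in> M" "T \<in> M" "b \<in> B"
  shows "rep (x * C (l, S, \<one>\<^bsub>R\<^esub>, T)) (C (l, S', b, T)) =
    rep (x * C (l, S, \<one>\<^bsub>R\<^esub>, S)) (C (l, S', b, S))" (is "?L = ?f b")
proof -
  have "?L = (\<Sum>c\<in>{c \<in> B. ?f c \<noteq> 0}. ?f c * of_int (kappa R B b (c \<otimes>\<^bsub>R\<^esub> \<one>\<^bsub>R\<^esub>)))"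
    using cell_formula(1)[OF l assms(1,3) F(2) assms(2,3,4)] by simp
  also have "\<dots> = (\<Sum>c\<in>{c \<in> B. ?f c \<noteq> 0}. if b = c then ?f c else 0)"
    by (intro sum.cong refl) (auto simp: kappa_mult_one(1)[OF F(1)])
  also have "\<dots> = ?f b"
    using cell_formula(2)[OF l assms(1,3) F(2) assms(2,3,4)] assms(4) by (simp add: sum.delta')
  finally show ?thesis .
qed

text \<open>By \<open>column_change\<close> a single Laurent polynomial \<open>?p\<close> is the
  coordinate of the product with \<open>(l, U, 1, V)\<close> at \<open>(l, S, b, V)\<close>, for
  every \<open>V\<close>. By (A4) its degree is the a-value of \<open>(l, S, b, V)\<close>, which
  therefore cannot depend on \<open>V\<close>.\<close>

lemma a_column:
  assumes "S \<in> M" "T \<in> M" "U \<in> M" "b \<in> B"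
  shows "a (l, S, b, T) = a (l, S, b, U)"
proof -
  let ?p = "g (l, S, b, U) (l, U, \<one>\<^bsub>R\<^esub>, U) (l, S, b, U)"
  have t: "(l, S, b, V) \<in> triples D" "(l, U, \<one>\<^bsub>R\<^esub>, V) \<in> triples D" if "V \<in> M" for V
    using that assms l F by auto
  have p: "g (l, S, b, U) (l, U, \<one>\<^bsub>R\<^esub>, V) (l, S, b, V) = ?p" if "V \<in> M" for V
    using column_change[OF assms(3,1) that assms(4)] by simp
  have "Poly_Mapping.lookup ?p (a (l, S, b, V)) \<noteq> 0" if "V \<in> M" for V
    using \<gamma>_nonzero_iff[OF t(1)[OF assms(3)] t(2)[OF that] t(1)[OF that]]
    unfolding \<gamma>_eq p[OF that] using assms by (simp add: kappa_mult_one(1)[OF F(1)])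
  moreover have "n \<le> a (l, S, b, V)" if "V \<in> M" "Poly_Mapping.lookup ?p n \<noteq> 0" for V n
    using degree_le_a[OF t(1)[OF assms(3)] t(2)[OF that(1)] t(1)[OF that(1)]] that(2)
    unfolding p[OF that(1)] .
  ultimately show ?thesis using assms by (meson order_antisym)
qed

text \<open>The star interchanges rows and columns without changing a-values, so
  \<open>a_column\<close> also gives independence of the row.\<close>

lemma a_row_column:
  assumes "S \<in> M" "T \<in> M" "S' \<in> M" "T' \<in> M" "b \<in> B"
  shows "a (l, S, b, T) = a (l, S', b, T')"
proof -
  have fl: "a (l, V, tbar R B b, U) = a (l, U, b, V)" if "U \<in> M" "V \<in> M" for U V
    using a_flip[of "(l, U, b, V)"] that l assms(5) by simp
  have "a (l, S, b, T) = a (l, S, b, T')" using assms by (intro a_column)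
  also have "\<dots> = a (l, T', tbar R B b, S)" using fl assms by simp
  also have "\<dots> = a (l, T', tbar R B b, S')" using assms F(3) by (intro a_column)
  also have "\<dots> = a (l, S', b, T')" using fl assms by simp
  finally show ?thesis .
qed

text \<open>The same polynomial \<open>?f b\<close> is a coordinate at entry \<open>b\<close> of a
  product with the unit, and a coordinate at entry 1 of a product with the bar of \<open>b\<close>.
  By (A4) it attains the top degree in both roles, so the two a-values bound each other.\<close>

lemma a_one:
  assumes "S \<in> M" "b \<in> B"
  shows "a (l, S, b, S) = a (l, S, \<one>\<^bsub>R\<^esub>, S)"
proof -
  let ?b = "tbar R B b"
  let ?f = "\<lambda>c. g (l, S, b, S) (l, S, \<one>\<^bsub>R\<^esub>, S) (l, S, c, S)"
  have t: "(l, S, c, S) \<in> triples D" if "c \<in> B" for c using that assms l by simp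
  have bb: "?b \<in> B" using F(3) assms by simp
  note cf = cell_formula[OF l assms(1) assms(1) bb assms(1) assms(1) F(2), where x = "C (l, S, b, S)"]
  have "g (l, S, b, S) (l, S, ?b, S) (l, S, \<one>\<^bsub>R\<^esub>, S) =
      (\<Sum>c\<in>{c \<in> B. ?f c \<noteq> 0}. ?f c * of_int (kappa R B \<one>\<^bsub>R\<^esub> (c \<otimes>\<^bsub>R\<^esub> ?b)))"
    using cf(1) by simp
  \<comment> \<open>The unit occurs in the product of \<open>c\<close> with the bar of
    \<open>b\<close> only for \<open>c = b\<close>.\<close>
  also have "\<dots> = (\<Sum>c\<in>{c \<in> B. ?f c \<noteq> 0}. if b = c then ?f c else 0)"
    using tbar_tbar[OF F(1)] assms(2) bb
    by (intro sum.cong refl) (auto simp: kappa_one[OF F(1)], metis)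
  also have "\<dots> = ?f b"
    using cf(2) assms by (simp add: sum.delta')
  finally have e: "g (l, S, b, S) (l, S, ?b, S) (l, S, \<one>\<^bsub>R\<^esub>, S) = ?f b" .
  have "a (l, S, \<one>\<^bsub>R\<^esub>, S) \<le> a (l, S, b, S)"
    using degree_le_a[OF t[OF assms(2)] t[OF F(2)] t[OF assms(2)]]
      \<gamma>_nonzero_iff[OF t[OF assms(2)] t[OF bb] t[OF F(2)]]
    unfolding \<gamma>_eq e using kappa_one[OF F(1) assms(2) bb] by simp
  moreover have "a (l, S, b, S) \<le> a (l, S, \<one>\<^bsub>R\<^esub>, S)"
    using degree_le_a[OF t[OF assms(2)] t[OF bb] t[OF F(2)]]
      \<gamma>_nonzero_iff[OF t[OF assms(2)] t[OF F(2)] t[OF assms(2)]]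
    unfolding \<gamma>_eq e using kappa_mult_one(1)[OF F(1) assms(2)] by simp
  ultimately show ?thesis by simp
qed

lemma a_constant:
  assumes "S \<in> M" "T \<in> M" "S' \<in> M" "T' \<in> M" "b \<in> B" "b' \<in> B"
  shows "a (l, S, b, T) = a (l, S', b', T')"
  using a_row_column a_one assms F(2) by metis

text \<open>Compare coefficients in \<open>cell_formula\<close> at the common a-value. Constancy of
  the a-function makes each coefficient of \<open>?f c\<close> a value of \<gamma> on a product with
  the unit, which vanishes for \<open>c\<close> other than \<open>b\<close>; one term
  survives.\<close>

lemma \<gamma>_leading:
  assumes "S \<in> M" "U \<in> M" "T \<in> M" "b \<in> B" "b' \<in> B" "b'' \<in> B"
  shows "\<gamma> (l, S, b, U) (l, U, b', T) (l, S, b'', T) =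
    \<gamma> (l, S, b, U) (l, U, \<one>\<^bsub>R\<^esub>, U) (l, S, b, U) * kappa R B b'' (b \<otimes>\<^bsub>R\<^esub> b')"
proof -
  let ?f = "\<lambda>c. g (l, S, b, U) (l, U, \<one>\<^bsub>R\<^esub>, U) (l, S, c, U)"
  let ?n = "a (l, S, b'', T)"
  note cf = cell_formula[OF l assms(2,3,5,1,3,6), where x = "C (l, S, b, U)"]
  have n: "?n = a (l, S, c, U)" if "c \<in> B" for c
    using a_constant[OF assms(1,3,1,2,6) that] .
  have z: "Poly_Mapping.lookup (?f c) ?n = (if b = c then \<gamma> (l, S, b, U) (l, U, \<one>\<^bsub>R\<^esub>, U) (l, S, b, U) else 0)"
    if c: "c \<in> B" for c
    using \<gamma>_nonzero_iff[of "(l, S, b, U)" "(l, U, \<one>\<^bsub>R\<^esub>, U)" "(l, S, c, U)"] assms l F(2) c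
    unfolding n[OF c] by (cases "b = c") (simp_all add: \<gamma>_eq kappa_mult_one(1)[OF F(1)])
  have "\<gamma> (l, S, b, U) (l, U, b', T) (l, S, b'', T) =
    (\<Sum>c\<in>{c \<in> B. ?f c \<noteq> 0}. Poly_Mapping.lookup (?f c) ?n * kappa R B b'' (c \<otimes>\<^bsub>R\<^esub> b'))"
    unfolding \<gamma>_eq cf(1) by (simp add: lookup_sum lookup_mult_of_int)
  also have "\<dots> = (\<Sum>c\<in>{c \<in> B. ?f c \<noteq> 0}. if b = c then
      \<gamma> (l, S, b, U) (l, U, \<one>\<^bsub>R\<^esub>, U) (l, S, b, U) * kappa R B b'' (b \<otimes>\<^bsub>R\<^esub> b') else 0)"
    by (intro sum.cong refl) (auto simp: z)
  also have "\<dots> = \<gamma> (l, S, b, U) (l, U, \<one>\<^bsub>R\<^esub>, U) (l, S, b, U) * kappa R B b'' (b \<otimes>\<^bsub>R\<^esub> b')"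
    using cf(2) assms(4) by (simp add: sum.delta' \<gamma>_eq)
  finally show ?thesis .
qed

text \<open>The star moves the unit to the left factor. There \<open>\<gamma>_leading\<close>
  applies with the unit as first entry, and its remaining factor is the value 1 prescribed by
  (A4).\<close>

lemma \<gamma>_leading_one:
  assumes "S \<in> M" "U \<in> M" "b \<in> B"
  shows "\<gamma> (l, S, b, U) (l, U, \<one>\<^bsub>R\<^esub>, U) (l, S, b, U) = 1"
proof -
  let ?b = "tbar R B b"
  have bb: "?b \<in> B" using F(3) assms by simp
  have "\<gamma> (l, S, b, U) (l, U, \<one>\<^bsub>R\<^esub>, U) (l, S, b, U) =
      \<gamma> (l, U, \<one>\<^bsub>R\<^esub>, U) (l, U, ?b, S) (l, U, ?b, S)"
    using \<gamma>_flip[of "(l, S, b, U)" "(l, U, \<one>\<^bsub>R\<^esub>, U)" "(l, S, b, U)"] assms l F(2) tbar_one[OF F(1)] by simp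
  also have "\<dots> = 1"
    using \<gamma>_leading[OF assms(2,2,1) F(2) bb bb] \<gamma>_one[OF l assms(2)]
      kappa_mult_one(2)[OF F(1) bb] by simp
  finally show ?thesis .
qed

end

text \<open>The asymptotic structure constants are thus recovered from the multiplication and the
  basis alone, so an algebra automorphism permuting the basis must preserve them.\<close>

theorem \<gamma>_eq_asymp_coeff:
  assumes t: "t \<in> triples D" and y: "y \<in> triples D" and z: "z \<in> triples D"
  shows "\<gamma> t y z = asymp_coeff D t y z"
proof (cases "asymp_coeff D t y z = 0")
  case True
  then show ?thesis using \<gamma>_nonzero_iff[OF t y z] by simp
next
  case False
  obtain l S b T where tt: "t = (l, S, b, T)" by (cases t)
  obtain l' U b' V where yy: "y = (l', U, b', V)" by (cases y)
  obtain l'' X b'' Y where zz: "z = (l'', X, b'', Y)" by (cases z)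
  have *: "l' = l" "l'' = l" "U = T" "X = S" "V = Y"
    using False by (simp_all add: tt yy zz split: if_splits)
  have l: "l \<in> index_set D" using t by (simp add: tt)
  show ?thesis
    using \<gamma>_leading[OF l, of S T Y b b' b''] \<gamma>_leading_one[OF l, of S T b] t y z
    by (simp add: tt yy zz *)
qed

end

section \<open>Automorphisms of table data\<close>

text \<open>Changing the order leaves triples and coefficients alone, so data for two orders with
  the same \<open>C\<close> can be compared through \<open>cell_action\<close>.\<close>

lemma index_le_update [simp]:
  "triples (D\<lparr>index_le := r\<rparr>) = triples D"
  "cell_dom (D\<lparr>index_le := r\<rparr>) = cell_dom D"
  "table_family (D\<lparr>index_le := r\<rparr>) = table_family D"
  "left_unit (D\<lparr>index_le := r\<rparr>) t = left_unit D t"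
  "asymp_coeff (D\<lparr>index_le := r\<rparr>) t y z = asymp_coeff D t y z"
proof -
  show "asymp_coeff (D\<lparr>index_le := r\<rparr>) t y z = asymp_coeff D t y z"
    by (cases t; cases y; cases z) auto
  show "left_unit (D\<lparr>index_le := r\<rparr>) t = left_unit D t" by (cases t) simp
qed (simp_all add: triples_def cell_dom_def table_family_def fun_eq_iff)

lemma rtrancl_map:
  assumes "(x, y) \<in> r\<^sup>*" and step: "\<And>m n. (m, n) \<in> r \<Longrightarrow> (f m, f n) \<in> s"
  shows "(f x, f y) \<in> s\<^sup>*"
  using assms(1) by induction (auto intro: step rtrancl_into_rtrancl)

lemma table_setting_if_A1:
  assumes "laurent_algebra scale" "axiom_A1 scale D C" "C ` triples D = BB"
  shows "table_setting scale BB D C"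
  using assms by unfold_locales (auto simp: axiom_A1_def table_family_def)

lemma tabular_if_reduced_trace_datum:
  assumes alg: "laurent_algebra scale" and rtd: "reduced_trace_datum scale \<tau> BB D C"
  shows "tabular scale BB D C"
proof -
  have A: "axiom_A1 scale D C" "axiom_A2 scale D C" "axiom_A3 scale D C"
      "a_exists scale (C ` triples D)" "axiom_A4 scale D C" "C ` triples D = BB"
    using rtd unfolding reduced_trace_datum_def table_datum_def by blast+
  interpret table_setting scale BB D C by (rule table_setting_if_A1[OF alg A(1,6)])
  show ?thesis
    using A(2,5) A(4)[unfolded A(6)] cell_action_if_axiom_A3[OF A(3)] by unfold_locales
qed

section \<open>The order generated by the left action of the algebra\<close>

context table_setting
begin

text \<open>The generating relation of the left preorder in the style of Kazhdan and Lusztig,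
  projected from basis elements to cells.\<close>

definition cell_steps :: "('l \<times> 'l) set" where
  "cell_steps = {(fst z, fst t) | x t z. t \<in> triples D \<and> z \<in> triples D \<and> rep (x * C t) (C z) \<noteq> 0}"

lemma cell_steps_subset: "cell_action scale D C \<Longrightarrow> cell_steps \<subseteq> index_le D"
  unfolding cell_steps_def cell_action_iff by (fastforce simp del: in_triples)

text \<open>The order generated by the steps is contained in the given one and still supports a
  table datum, so reducedness forbids it to be strictly smaller.\<close>

lemma index_le_subset_cell_steps:
  assumes td: "table_datum scale D C" and red: "reduced scale D C"
  shows "index_le D \<subseteq> cell_steps\<^sup>*"
proof -
  have A: "axiom_A1 scale D C" "axiom_A2 scale D C" "axiom_A3 scale D C"
    using td unfolding table_datum_def by simp_all
  have act: "cell_action scale D C" by (rule cell_action_if_axiom_A3[OF A(3)])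
  let ?L = "index_set D"
  \<comment> \<open>The reflexive closure relates every element of the type to itself, whereas an
    order on \<open>?L\<close> must stay inside \<open>?L\<close>.\<close>
  define r where "r = cell_steps\<^sup>* \<inter> ?L \<times> ?L"
  have po: "index_le D \<subseteq> ?L \<times> ?L" "refl_on ?L (index_le D)" "trans (index_le D)" "antisym (index_le D)"
    using order unfolding partial_order_on_def preorder_on_def by auto
  have "r \<subseteq> index_le D"
  proof clarify
    fix k l assume "(k, l) \<in> r"
    then have kl: "(k, l) \<in> cell_steps\<^sup>*" "k \<in> ?L" unfolding r_def by auto
    have "(k, l) \<in> (index_le D)\<^sup>*" using kl(1) rtrancl_mono[OF cell_steps_subset[OF act]] by blast
    then show "(k, l) \<in> index_le D"
      using po(2,3) kl(2) by (metis refl_onD rtranclD trancl_id)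
  qed
  moreover have r: "partial_order_on ?L r"
    unfolding partial_order_on_def preorder_on_def
  proof (intro conjI)
    show "antisym r" using \<open>r \<subseteq> index_le D\<close> po(4) by (meson antisym_def subsetD)
    show "trans r" unfolding r_def trans_def by (auto intro: rtrancl_trans)
  qed (auto simp: r_def refl_on_def)
  \<comment> \<open>In \<open>cell_action\<close> the order occurs only in the first clause, which
    asks precisely that all steps belong to it.\<close>
  moreover have "table_datum scale (D\<lparr>index_le := r\<rparr>) C"
  proof -
    have A1: "axiom_A1 scale (D\<lparr>index_le := r\<rparr>) C" using A(1) r unfolding axiom_A1_def by simp
    have A2: "axiom_A2 scale (D\<lparr>index_le := r\<rparr>) C" using A(2) unfolding axiom_A2_def by simp
    interpret D': table_setting scale BB "D\<lparr>index_le := r\<rparr>" C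
      by (rule table_setting_if_A1[OF alg A1]) (simp add: image)
    have "cell_action scale (D\<lparr>index_le := r\<rparr>) C"
      unfolding D'.cell_action_iff
    proof (intro allI ballI conjI impI)
      fix x t z assume tz: "t \<in> triples (D\<lparr>index_le := r\<rparr>)" "z \<in> triples (D\<lparr>index_le := r\<rparr>)"
        and "rep (x * C t) (C z) \<noteq> 0"
      then have "(fst z, fst t) \<in> cell_steps" unfolding cell_steps_def index_le_update by blast
      then show "(fst z, fst t) \<in> index_le (D\<lparr>index_le := r\<rparr>)"
        using fst_in_index_set[OF tz(1)[unfolded index_le_update]]
          fst_in_index_set[OF tz(2)[unfolded index_le_update]] by (simp add: r_def)
    qed (use act[unfolded cell_action_iff] in simp)
    then show ?thesis using A1 A2 D'.axiom_A3_if_cell_action unfolding table_datum_def by blast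
  qed
  ultimately have "\<not> r \<subset> index_le D" using red unfolding reduced_def by blast
  then show ?thesis using \<open>r \<subseteq> index_le D\<close> unfolding r_def by blast
qed

end

section \<open>Permutations of the triples that also respect the order of the cells\<close>

locale table_automorphism = asymp_automorphism D \<theta>
  for D :: "('l, 'g, 'm, 'a::ring) table_object" and \<theta> +
  fixes \<pi> :: "'l \<Rightarrow> 'l"
  assumes fst_image: "\<And>t. t \<in> triples D \<Longrightarrow> fst (\<theta> t) = \<pi> (fst t)"
    and bij_index: "bij_betw \<pi> (index_set D) (index_set D)"
    and le_image: "\<And>k l. k \<in> index_set D \<Longrightarrow> l \<in> index_set D \<Longrightarrow>
      (\<pi> k, \<pi> l) \<in> index_le D \<longleftrightarrow> (k, l) \<in> index_le D"
begin

lemma inverse_table_automorphism: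
  "table_automorphism D (inv_into (triples D) \<theta>) (inv_into (index_set D) \<pi>)"
proof -
  let ?i = "inv_into (triples D) \<theta>" and ?p = "inv_into (index_set D) \<pi>"
  interpret i: asymp_automorphism D ?i by (rule inverse_automorphism)
  have p: "?p k \<in> index_set D" "\<pi> (?p k) = k" if "k \<in> index_set D" for k
    using that bij_index bij_betw_inv_into[OF bij_index] by (auto simp: bij_betw_def f_inv_into_f)
  show ?thesis
  proof
    show "bij_betw ?p (index_set D) (index_set D)" by (rule bij_betw_inv_into[OF bij_index])
    show "(?p k, ?p l) \<in> index_le D \<longleftrightarrow> (k, l) \<in> index_le D"
      if "k \<in> index_set D" "l \<in> index_set D" for k l
      using le_image[OF p(1)[OF that(1)] p(1)[OF that(2)]] p(2) that by simp
    fix t assume t: "t \<in> triples D"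
    have "\<theta> (?i t) = t" using bij t by (auto simp: bij_betw_def f_inv_into_f)
    then have "\<pi> (fst (?i t)) = fst t" using fst_image[OF i.in_triples_image[OF t]] by simp
    then show "fst (?i t) = ?p (fst t)"
      using bij_index fst_in_index_set[OF i.in_triples_image[OF t]] by (metis bij_betw_def inv_into_f_f)
  qed
qed

lemma bij_betw_filter: "bij_betw \<theta> {y \<in> triples D. P (\<theta> y)} {y \<in> triples D. P y}"
proof (rule bij_betw_imageI)
  show "inj_on \<theta> {y \<in> triples D. P (\<theta> y)}"
    using bij by (auto simp: bij_betw_def inj_on_def)
  show "\<theta> ` {y \<in> triples D. P (\<theta> y)} = {y \<in> triples D. P y}"
  proof (intro equalityI subsetI)
    fix y assume "y \<in> {y \<in> triples D. P y}"
    moreover then obtain x where "x \<in> triples D" "y = \<theta> x"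
      using bij by (metis (no_types, lifting) bij_betw_imp_surj_on imageE mem_Collect_eq)
    ultimately show "y \<in> \<theta> ` {y \<in> triples D. P (\<theta> y)}" by simp
  qed (auto simp: in_triples_image)
qed

text \<open>Every axiom is brought to a form involving only the basis, the order and the asymptotic
  structure constants: (A2) through \<open>flip\<close>, (A3) through \<open>cell_action\<close>,
  (A4) through \<open>top_degree_iff\<close> and \<open>\<gamma>_eq_asymp_coeff\<close>, (A5)
  through \<open>diagonal\<close>.\<close>

theorem reduced_trace_datum_comp:
  assumes alg: "laurent_algebra scale" and rtd: "reduced_trace_datum scale \<tau> BB D C"
  shows "reduced_trace_datum scale \<tau> BB D (C \<circ> \<theta>)"
proof -
  interpret T: tabular scale BB D C by (rule tabular_if_reduced_trace_datum[OF alg rtd])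
  let ?C = "C \<circ> \<theta>"
  have A: "axiom_A1 scale D C" "axiom_A2 scale D C" "axiom_A5 scale \<tau> D C"
      "table_datum scale D C" "reduced scale D C"
    using rtd unfolding reduced_trace_datum_def table_datum_def by simp_all
  have img: "?C ` triples D = BB"
    unfolding image_comp[symmetric] using bij T.image by (simp add: bij_betw_def)
  have "inj_on ?C (triples D)"
    using bij T.inj by (simp add: comp_inj_on bij_betw_def)
  then have A1: "axiom_A1 scale D ?C"
    using A(1) unfolding axiom_A1_def img T.image by simp
  interpret T': table_setting scale BB D ?C by (rule table_setting_if_A1[OF alg A1 img])
  have A2: "axiom_A2 scale D ?C"
    unfolding axiom_A2_def
  proof (intro conjI ballI)
    fix l S T b assume "l \<in> index_set D" "S \<in> mat_index D l" "T \<in> mat_index D l" "b \<in> table_basis D l"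
    then have t: "(l, S, b, T) \<in> triples D" by simp
    show "star D (?C (l, S, b, T)) = ?C (l, T, tbar (table_alg D l) (table_basis D l) b, S)"
      using T.star_C[OF in_triples_image[OF t]] flip_image[OF t] by simp
  qed (use A(2) in \<open>simp add: axiom_A2_def\<close>)
  have act: "cell_action scale D ?C"
    unfolding T'.cell_action_iff
  proof (intro allI ballI conjI impI)
    fix x t z assume t: "t \<in> triples D" and z: "z \<in> triples D"
    note tz = in_triples_image[OF t] in_triples_image[OF z]
    note old = T.act[unfolded T.cell_action_iff, rule_format, OF tz]
    show "(fst z, fst t) \<in> index_le D" if "T.rep (x * ?C t) (?C z) \<noteq> 0"
    proof -
      have "(fst (\<theta> z), fst (\<theta> t)) \<in> index_le D" using old that by simp
      then show ?thesis by (simp add: fst_image t z le_image fst_in_index_set)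
    qed
    assume "fst z = fst t"
    then have "fst (\<theta> z) = fst (\<theta> t)" by (simp add: fst_image t z)
    let ?f = "\<lambda>y. T.rep (x * C (left_unit D (\<theta> t))) (C y)"
    have "T.rep (x * ?C t) (?C z) =
        (\<Sum>y\<in>{y \<in> triples D. ?f y \<noteq> 0}. ?f y * of_int (asymp_coeff D y (\<theta> t) (\<theta> z)))"
      using old \<open>fst (\<theta> z) = fst (\<theta> t)\<close> by simp
    \<comment> \<open>Here it pays that the sum runs over all triples: it can be reindexed along
      \<theta>.\<close>
    also have "\<dots> = (\<Sum>y\<in>{y \<in> triples D. ?f (\<theta> y) \<noteq> 0}.
        ?f (\<theta> y) * of_int (asymp_coeff D (\<theta> y) (\<theta> t) (\<theta> z)))"
      by (rule sum.reindex_bij_betw[OF bij_betw_filter, symmetric])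
    also have "\<dots> = (\<Sum>y\<in>{y \<in> triples D. ?f (\<theta> y) \<noteq> 0}. ?f (\<theta> y) * of_int (asymp_coeff D y t z))"
      using t z by (intro sum.cong refl) (simp add: asymp_eq)
    finally show "T.rep (x * ?C t) (?C z) =
      (\<Sum>y\<in>{y \<in> triples D. T.rep (x * ?C (left_unit D t)) (?C y) \<noteq> 0}.
         T.rep (x * ?C (left_unit D t)) (?C y) * of_int (asymp_coeff D y t z))"
      by (simp add: left_unit_image[OF t])
  qed
  have td: "table_datum scale D ?C"
    using A1 A2 T'.axiom_A3_if_cell_action[OF act] unfolding table_datum_def by blast
  have A4: "axiom_A4 scale D ?C"
    unfolding axiom_A4_def Let_def img strc_def
  proof (intro ballI, unfold split_paired_all prod.case, intro ballI, unfold split_paired_all prod.case,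
      intro ballI, unfold split_paired_all prod.case)
    fix l S b T l' U b' V l'' X b'' Y
    assume t: "(l, S, b, T) \<in> triples D" and y: "(l', U, b', V) \<in> triples D"
      and z: "(l'', X, b'', Y) \<in> triples D"
    let ?t = "(l, S, b, T)" and ?y = "(l', U, b', V)" and ?z = "(l'', X, b'', Y)"
    let ?R = "table_alg D l"
    note i = in_triples_image[OF t] in_triples_image[OF y] in_triples_image[OF z]
    let ?match = "l = l' \<and> l = l'' \<and> X = S \<and> T = U \<and> Y = V \<and>
      kappa ?R (table_basis D l) b'' (b \<otimes>\<^bsub>?R\<^esub> b') \<noteq> 0"
    have m: "?match \<longleftrightarrow> asymp_coeff D ?t ?y ?z \<noteq> 0" by auto
    show "(T.rep (?C ?t * ?C ?y) (?C ?z) \<noteq> 0 \<and> ldeg (T.rep (?C ?t * ?C ?y) (?C ?z)) = a_fun scale BB (?C ?z)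
        \<longleftrightarrow> ?match) \<and>
      (?match \<and> b = \<one>\<^bsub>?R\<^esub> \<and> b' = \<one>\<^bsub>?R\<^esub> \<and> b'' = \<one>\<^bsub>?R\<^esub> \<longrightarrow> gamma scale BB (?C ?t) (?C ?y) (?C ?z) = 1)"
    proof (intro conjI impI)
      show "T.rep (?C ?t * ?C ?y) (?C ?z) \<noteq> 0 \<and>
          ldeg (T.rep (?C ?t * ?C ?y) (?C ?z)) = a_fun scale BB (?C ?z) \<longleftrightarrow> ?match"
        unfolding m using T.top_degree_iff[OF i] asymp_eq[OF t y z] by simp
      assume *: "?match \<and> b = \<one>\<^bsub>?R\<^esub> \<and> b' = \<one>\<^bsub>?R\<^esub> \<and> b'' = \<one>\<^bsub>?R\<^esub>"
      have "l \<in> index_set D" using t by simp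
      note F = table_familyD[OF family this]
      \<comment> \<open>Off the diagonal the image of a triple with entry 1 may have a different
        entry, where (A4) for \<open>C\<close> prescribes no value; the identification with the
        asymptotic coefficients supplies it.\<close>
      have "gamma scale BB (?C ?t) (?C ?y) (?C ?z) = asymp_coeff D ?t ?y ?z"
        using T.\<gamma>_eq_asymp_coeff[OF i] asymp_eq[OF t y z] by (simp del: asymp_coeff.simps)
      also have "\<dots> = kappa ?R (table_basis D l) b'' (b \<otimes>\<^bsub>?R\<^esub> b')" using * by auto
      also have "\<dots> = 1" using * kappa_mult_one(1)[OF F(1,2)] by simp
      finally show "gamma scale BB (?C ?t) (?C ?y) (?C ?z) = 1" .
    qed
  qed
  have A5: "axiom_A5 scale \<tau> D ?C"
    unfolding axiom_A5_def Let_def img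
  proof (intro conjI ballI, unfold split_paired_all prod.case)
    fix l S b T assume t: "(l, S, b, T) \<in> triples D"
    let ?t = "(l, S, b, T)"
    obtain l' S' b' T' where tt: "\<theta> ?t = (l', S', b', T')" by (cases "\<theta> ?t")
    have "S' = T' \<and> b' = \<one>\<^bsub>table_alg D l'\<^esub> \<longleftrightarrow> S = T \<and> b = \<one>\<^bsub>table_alg D l\<^esub>"
      using diagonal_image[OF t] by (simp add: tt)
    moreover have "(l', S', b', T') \<in> triples D" using in_triples_image[OF t] by (simp only: tt)
    ultimately show "\<tau> (scale (vpow (a_fun scale BB (?C ?t))) (?C ?t))
        - (if S = T \<and> b = \<one>\<^bsub>table_alg D l\<^esub> then 1 else 0) \<in> vinv_Aminus"
      using A(3)[unfolded axiom_A5_def Let_def T.image, THEN conjunct2, THEN conjunct2, THEN conjunct2,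
          THEN bspec, of "\<theta> ?t"] tt by simp
  qed (use A(3) in \<open>simp_all add: axiom_A5_def\<close>)
  \<comment> \<open>The steps for \<open>C\<close> become steps for \<open>?C\<close> under the
    inverse of \<pi>, so the order is generated by the steps for \<open>?C\<close> too.\<close>
  have steps: "index_le D \<subseteq> T'.cell_steps\<^sup>*"
  proof clarify
    fix k l assume kl: "(k, l) \<in> index_le D"
    let ?p = "inv_into (index_set D) \<pi>"
    have L: "k \<in> index_set D" "l \<in> index_set D"
      using kl T.order unfolding partial_order_on_def preorder_on_def by auto
    have p: "?p (\<pi> m) = m" if "m \<in> index_set D" for m
      using that bij_index by (simp add: bij_betw_def)
    have step: "(?p m, ?p n) \<in> T'.cell_steps" if mn: "(m, n) \<in> T.cell_steps" for m n
    proof -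
      obtain x t z where x: "t \<in> triples D" "z \<in> triples D" "T.rep (x * C t) (C z) \<noteq> 0"
          "m = fst z" "n = fst t"
        using mn unfolding T.cell_steps_def by auto
      obtain t' z' where t': "t' \<in> triples D" "t = \<theta> t'" "z' \<in> triples D" "z = \<theta> z'"
        using triples_imageE[OF x(1)] triples_imageE[OF x(2)] by metis
      have "?p m = fst z'" "?p n = fst t'"
        using x t' by (simp_all add: fst_image p fst_in_index_set)
      moreover have "T.rep (x * ?C t') (?C z') \<noteq> 0" using x(3) t' by simp
      ultimately show ?thesis using t' unfolding T'.cell_steps_def by blast
    qed
    have "(\<pi> k, \<pi> l) \<in> T.cell_steps\<^sup>*"
      using le_image[OF L] kl T.index_le_subset_cell_steps[OF A(4,5)] by blast
    then have "(?p (\<pi> k), ?p (\<pi> l)) \<in> T'.cell_steps\<^sup>*"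
      by (rule rtrancl_map[OF _ step])
    then show "(k, l) \<in> T'.cell_steps\<^sup>*" using p L by simp
  qed
  have "reduced scale D ?C"
    unfolding reduced_def
  proof
    assume "\<exists>r. partial_order_on (index_set D) r \<and> r \<subset> index_le D \<and> table_datum scale (D\<lparr>index_le := r\<rparr>) ?C"
    then obtain r where r: "partial_order_on (index_set D) r" "r \<subset> index_le D"
      and tdr: "table_datum scale (D\<lparr>index_le := r\<rparr>) ?C" by blast
    then have Ar: "axiom_A1 scale (D\<lparr>index_le := r\<rparr>) ?C" "axiom_A3 scale (D\<lparr>index_le := r\<rparr>) ?C"
      unfolding table_datum_def by simp_all
    interpret Tr: table_setting scale BB "D\<lparr>index_le := r\<rparr>" ?C
      by (rule table_setting_if_A1[OF alg Ar(1)]) (simp only: index_le_update img)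
    have "Tr.cell_steps \<subseteq> r" using Tr.cell_steps_subset[OF Tr.cell_action_if_axiom_A3[OF Ar(2)]] by simp
    moreover have "Tr.cell_steps = T'.cell_steps" unfolding Tr.cell_steps_def T'.cell_steps_def by simp
    ultimately have "index_le D \<subseteq> r\<^sup>*" using steps rtrancl_mono by blast
    moreover have "(k, l) \<in> r" if "(k, l) \<in> r\<^sup>*" "k \<in> index_set D" for k l
      using that r(1) unfolding partial_order_on_def preorder_on_def
      by (metis refl_onD rtranclD trancl_id)
    moreover have "index_le D \<subseteq> index_set D \<times> index_set D"
      using T.order unfolding partial_order_on_def preorder_on_def by auto
    ultimately show False using r(2) by blast
  qed
  then show ?thesis
    unfolding reduced_trace_datum_def img using td T.ae A4 A5 by blast
qed

text \<open>Take \<open>C \<circ> ?i\<close> as second map: inverting it after \<open>C\<close>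
  gives \<theta>. The fixed \<open>C\<close> of the category may differ from the one at hand, which
  is harmless since precomposition preserves every reduced datum on \<open>D\<close>.\<close>

lemma restrict_in_cat_hom:
  assumes alg: "laurent_algebra scale" and ob: "D \<in> cat_objects scale \<tau> BB"
  shows "restrict \<theta> (triples D) \<in> cat_hom scale \<tau> BB D D"
proof -
  define C where "C = fixed_C scale \<tau> BB D"
  have rtd: "reduced_trace_datum scale \<tau> BB D C"
    using ob unfolding C_def fixed_C_def cat_objects_def mem_Collect_eq by (rule someI_ex)
  let ?i = "inv_into (triples D) \<theta>"
  interpret i: table_automorphism D ?i "inv_into (index_set D) \<pi>" by (rule inverse_table_automorphism)
  have rtd': "reduced_trace_datum scale \<tau> BB D (C \<circ> ?i)"
    by (rule i.reduced_trace_datum_comp[OF alg rtd])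
  have inj: "inj_on (C \<circ> ?i) (triples D)"
    using rtd' unfolding reduced_trace_datum_def table_datum_def axiom_A1_def by simp
  have "restrict \<theta> (triples D) = compose (triples D) (inv_into (triples D) (C \<circ> ?i)) C"
  proof
    fix t show "restrict \<theta> (triples D) t = compose (triples D) (inv_into (triples D) (C \<circ> ?i)) C t"
    proof (cases "t \<in> triples D")
      case True
      have "inv_into (triples D) (C \<circ> ?i) (C t) = \<theta> t"
        using bij True in_triples_image by (intro inv_into_f_eq inj) (auto simp: bij_betw_def)
      then show ?thesis using True by (simp add: compose_def)
    qed (simp add: compose_def)
  qed
  then show ?thesis unfolding cat_hom_def C_def[symmetric] using rtd' by blast
qed

lemma cat_automorphism_restrict:
  assumes alg: "laurent_algebra scale" and ob: "D \<in> cat_objects scale \<tau> BB"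
  shows "cat_automorphism scale \<tau> BB D (restrict \<theta> (triples D))"
proof -
  let ?i = "inv_into (triples D) \<theta>"
  interpret i: table_automorphism D ?i "inv_into (index_set D) \<pi>" by (rule inverse_table_automorphism)
  have "?i (\<theta> t) = t \<and> \<theta> (?i t) = t" if "t \<in> triples D" for t
    using that bij by (simp add: bij_betw_def f_inv_into_f)
  then have "compose (triples D) (restrict ?i (triples D)) (restrict \<theta> (triples D)) = restrict id (triples D)"
    "compose (triples D) (restrict \<theta> (triples D)) (restrict ?i (triples D)) = restrict id (triples D)"
    by (auto simp: compose_def restrict_def fun_eq_iff in_triples_image i.in_triples_image)
  then show ?thesis
    unfolding cat_automorphism_def
    using ob restrict_in_cat_hom[OF alg ob] i.restrict_in_cat_hom[OF alg ob] by blast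
qed

end

section \<open>The permutation of triples induced by an algebra automorphism\<close>

theorem proposition4p1p1:
  fixes scale :: "laurent \<Rightarrow> 'a::ring \<Rightarrow> 'a"
    and \<tau> :: "'a \<Rightarrow> laurent"
    and BB :: "'a set"
    and D :: "('l, 'g, 'm, 'a) table_object"
    and C :: "'l \<times> 'm \<times> 'g \<times> 'm \<Rightarrow> 'a"
    and \<phi> :: "'a \<Rightarrow> 'a"
  assumes "laurent_algebra scale"
    and "reduced_trace_datum scale \<tau> BB D C"
    and "algebra_automorphism scale \<phi>"
    and "\<phi> ` BB = BB"
  shows "\<exists>\<theta>. cat_automorphism scale \<tau> BB D \<theta> \<and>
           (\<forall>X\<in>BB. \<phi> X = (C \<circ> \<theta> \<circ> inv_into (triples D) C) X)"
proof -
  interpret T: tabular scale BB D C by (rule tabular_if_reduced_trace_datum[OF assms(1,2)])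
  have \<phi>: "module_hom scale scale \<phi>" "\<And>x y. \<phi> (x * y) = \<phi> x * \<phi> y" "inj \<phi>"
    using assms(3) unfolding algebra_automorphism_def bij_def by blast+
  define \<theta> where "\<theta> = inv_into (triples D) C \<circ> \<phi> \<circ> C"
  have C: "bij_betw C (triples D) BB" using T.inj T.image by (simp add: bij_betw_def)
  have \<phi>b: "bij_betw \<phi> BB BB" using \<phi>(3) assms(4) by (auto simp: bij_betw_def intro: inj_on_subset)
  have C\<theta>: "C (\<theta> t) = \<phi> (C t)" if "t \<in> triples D" for t
  proof -
    have "\<phi> (C t) \<in> C ` triples D" using T.C_in[OF that] assms(4) T.image by blast
    then show ?thesis unfolding \<theta>_def by (simp add: f_inv_into_f)
  qed
  have bij: "bij_betw \<theta> (triples D) (triples D)"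
    unfolding \<theta>_def comp_assoc using bij_betw_trans[OF bij_betw_trans[OF C \<phi>b] bij_betw_inv_into[OF C]]
    by (simp add: comp_assoc)
  have \<theta>_in: "\<theta> t \<in> triples D" if "t \<in> triples D" for t using that bij by (auto simp: bij_betw_def)
  have rep: "T.rep (\<phi> x) (C (\<theta> t)) = T.rep x (C t)" if "t \<in> triples D" for x t
    using T.rep_hom[OF \<phi>(1,3)] assms(4) T.C_in that C\<theta> by simp
  \<comment> \<open>The automorphism preserves coordinates and a-values, hence \<gamma>, which is
    the asymptotic coefficient.\<close>
  have "asymp_coeff D (\<theta> t) (\<theta> y) (\<theta> z) = asymp_coeff D t y z"
    if t: "t \<in> triples D" "y \<in> triples D" "z \<in> triples D" for t y z
  proof -
    have "T.a (\<theta> z) = T.a z"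
      using T.a_fun_hom[OF \<phi>(1,3) assms(4)] T.C_in C\<theta> \<phi>(2) t by simp
    moreover have "T.g (\<theta> t) (\<theta> y) (\<theta> z) = T.g t y z"
      using rep[OF t(3), of "C t * C y"] t by (simp add: \<phi>(2) C\<theta>)
    ultimately have "T.\<gamma> (\<theta> t) (\<theta> y) (\<theta> z) = T.\<gamma> t y z" unfolding T.\<gamma>_eq by simp
    then show ?thesis using T.\<gamma>_eq_asymp_coeff t \<theta>_in by simp
  qed
  then interpret asymp_automorphism D \<theta> using T.family bij by unfold_locales
  \<comment> \<open>The choice of the triple is immaterial because \<theta> maps cells into
    cells.\<close>
  define \<pi> where "\<pi> l = fst (\<theta> (SOME t. t \<in> triples D \<and> fst t = l))" for l
  have \<pi>: "fst (\<theta> t) = \<pi> (fst t)" if "t \<in> triples D" for t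
  proof -
    have "(SOME y. y \<in> triples D \<and> fst y = fst t) \<in> triples D \<and>
        fst (SOME y. y \<in> triples D \<and> fst y = fst t) = fst t"
      by (rule someI[of _ t]) (simp add: that)
    then show ?thesis unfolding \<pi>_def using same_cell_image[OF that] by simp
  qed
  have cell: "\<exists>t\<in>triples D. fst t = l" if "l \<in> index_set D" for l
  proof -
    have "mat_index D l \<noteq> {}" using T.family that by (simp add: table_family_def)
    then obtain S where "S \<in> mat_index D l" by auto
    then have "(l, S, \<one>\<^bsub>table_alg D l\<^esub>, S) \<in> triples D" using that table_familyD[OF T.family that] by simp
    then show ?thesis by (metis fst_conv)
  qed
  let ?L = "index_set D"
  have td: "table_datum scale D C" and red: "reduced scale D C"
    using assms(2) unfolding reduced_trace_datum_def by simp_all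
  have fin: "finite ?L" using td unfolding table_datum_def axiom_A1_def by simp
  have "\<pi> l \<in> ?L" if "l \<in> ?L" for l
    using cell[OF that] \<pi> \<theta>_in fst_in_index_set by metis
  moreover have "l \<in> \<pi> ` ?L" if l: "l \<in> ?L" for l
  proof -
    obtain t where "t \<in> triples D" "fst t = l" using cell[OF l] by blast
    moreover then obtain y where "y \<in> triples D" "t = \<theta> y" using bij by (metis bij_betw_imp_surj_on imageE)
    ultimately show ?thesis using \<pi> fst_in_index_set by blast
  qed
  ultimately have im: "\<pi> ` ?L = ?L" by blast
  then have bij_\<pi>: "bij_betw \<pi> ?L ?L" using finite_surj_inj[OF fin] by (simp add: bij_betw_def)
  have po: "index_le D \<subseteq> ?L \<times> ?L" "refl_on ?L (index_le D)" "trans (index_le D)"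
    using T.order unfolding partial_order_on_def preorder_on_def by auto
  \<comment> \<open>Reducedness enters here: the order is generated by steps, and \<phi> carries
    steps to steps.\<close>
  have mono: "(\<pi> k, \<pi> l) \<in> index_le D" if kl: "(k, l) \<in> index_le D" for k l
  proof -
    have step: "(\<pi> m, \<pi> n) \<in> T.cell_steps" if mn: "(m, n) \<in> T.cell_steps" for m n
    proof -
      obtain x t z where x: "t \<in> triples D" "z \<in> triples D" "T.rep (x * C t) (C z) \<noteq> 0"
          "m = fst z" "n = fst t"
        using mn unfolding T.cell_steps_def by auto
      have "T.rep (\<phi> x * C (\<theta> t)) (C (\<theta> z)) \<noteq> 0"
        using rep[OF x(2), of "x * C t"] x by (simp add: \<phi>(2) C\<theta>)
      then have "(fst (\<theta> z), fst (\<theta> t)) \<in> T.cell_steps"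
        unfolding T.cell_steps_def using \<theta>_in x by blast
      then show ?thesis using \<pi> x by simp
    qed
    have "(k, l) \<in> T.cell_steps\<^sup>*" using kl T.index_le_subset_cell_steps[OF td red] by blast
    then have "(\<pi> k, \<pi> l) \<in> T.cell_steps\<^sup>*"
      by (rule rtrancl_map[OF _ step])
    then have "(\<pi> k, \<pi> l) \<in> (index_le D)\<^sup>*"
      using rtrancl_mono[OF T.cell_steps_subset[OF T.act]] by blast
    moreover have "\<pi> k \<in> ?L" using im kl po(1) by blast
    ultimately show ?thesis using po(2,3) by (metis refl_onD rtranclD trancl_id)
  qed
  \<comment> \<open>An injective self-map of the finite set of related pairs is onto, so \<pi>
    reflects the order as well.\<close>
  have "map_prod \<pi> \<pi> ` index_le D = index_le D"
  proof (rule endo_inj_surj)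
    show "finite (index_le D)" using po(1) fin by (meson finite_SigmaI finite_subset)
    show "map_prod \<pi> \<pi> ` index_le D \<subseteq> index_le D" using mono by auto
    show "inj_on (map_prod \<pi> \<pi>) (index_le D)"
      using bij_\<pi> unfolding bij_betw_def by (intro inj_on_subset[OF map_prod_inj_on po(1)]) simp_all
  qed
  then have "(\<pi> k, \<pi> l) \<in> index_le D \<longleftrightarrow> (k, l) \<in> index_le D" if "k \<in> ?L" "l \<in> ?L" for k l
  proof (intro iffI)
    assume "(\<pi> k, \<pi> l) \<in> index_le D"
    then have "(\<pi> k, \<pi> l) \<in> map_prod \<pi> \<pi> ` index_le D"
      using \<open>map_prod \<pi> \<pi> ` index_le D = index_le D\<close> by simp
    then obtain k' l' where "(k', l') \<in> index_le D" "\<pi> k = \<pi> k'" "\<pi> l = \<pi> l'" by auto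
    moreover then have "k' \<in> ?L" "l' \<in> ?L" using po(1) by auto
    ultimately show "(k, l) \<in> index_le D" using that bij_\<pi> unfolding bij_betw_def by (metis inj_onD)
  qed (rule mono)
  then interpret table_automorphism D \<theta> \<pi> using \<pi> bij_\<pi> by unfold_locales
  have "D \<in> cat_objects scale \<tau> BB" using assms(2) unfolding cat_objects_def by blast
  then have "cat_automorphism scale \<tau> BB D (restrict \<theta> (triples D))"
    by (rule cat_automorphism_restrict[OF assms(1)])
  moreover have "\<phi> X = (C \<circ> restrict \<theta> (triples D) \<circ> inv_into (triples D) C) X" if X: "X \<in> BB" for X
  proof -
    obtain t where "t \<in> triples D" "X = C t" using X T.image by (metis imageE)
    then show ?thesis using C\<theta> T.inj by simp
  qed
  ultimately show ?thesis by blast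
qed

end
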